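(* Let $\mathcal H$ be a separable real Hilbert space, $p\ge2$, and for $i\in\{1,\dots,p\}$ let $\mu_i=\mathcal N(0,\Sigma_i)$ be a centered Gaussian measure on $\mathcal H$. Let $\{v_k\}_{k\in\mathbb N}$ be any total orthonormal set (orthonormal basis) of $\mathcal H$, and for each $i\in\{1,\dots,p\}$ let $\Sigma_i=Q_i\Lambda_iQ_i^*$ be a spectral decomposition of $\Sigma_i$, where $\Lambda_i=\sum_k\lambda_k(\Sigma_i)\,v_k\otimes v_k$ and $Q_i\in\mathcal U(\mathcal H)$. Then the Gaussian measure $$\mathcal N\left(0,\ \begin{bmatrix}\Sigma_1&Q_1\Lambda_1^{1/2}\Lambda_2^{1/2}Q_2^*&\cdots&Q_1\Lambda_1^{1/2}\Lambda_p^{1/2}Q_p^*\\ Q_2\Lambda_2^{1/2}\Lambda_1^{1/2}Q_1^*&\Sigma_2&\cdots&Q_2\Lambda_2^{1/2}\Lambda_p^{1/2}Q_p^*\\ \vdots&\vdots&\ddots&\vdots\\ Q_p\Lambda_p^{1/2}\Lambda_1^{1/2}Q_1^*&Q_p\Lambda_p^{1/2}\Lambda_2^{1/2}Q_2^*&\cdots&\Sigma_p\end{bmatrix}\right)$$ on $\bigoplus_{i=1}^p\mathcal H$ solves the multimarginal IGW problem between $\mu_1,\dots,\mu_p$, i.e. it belongs to $\Pi(\mu_1,\dots,\mu_p)$ and attains $$\inf_{\pi\in\Pi(\mu_1,\dots,\mu_p)}\int\sum_{i=1}^p\sum_{j=i+1}^p\big(\langle x_i,x_i'\rangle-\langle 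x_j,x_j'\rangle\big)^2\,d(\pi\otimes\pi)(x_1,\dots,x_p,x_1',\dots,x_p').$$
   Context: $\Pi(\mu_1,\dots,\mu_p)$ is the set of Borel probability measures on $\mathcal H^p$ whose $i$th marginal is $\mu_i$ for each $i$. $\mathcal N(0,\Sigma)$ is the centered Gaussian measure with covariance operator $\Sigma$ (self-adjoint, positive semidefinite, trace-class; possibly degenerate). The block matrix is interpreted as a block operator on $\bigoplus_{i=1}^p\mathcal H$. $\lambda_1(\Sigma)\ge\lambda_2(\Sigma)\ge\cdots$ are the eigenvalues of $\Sigma$ in non-increasing order, repeated according to multiplicity (if $\mathcal H$ is finite-dimensional, indices $k$ run over $1,\dots,\dim\mathcal H$). $v\otimes v$ denotes the rank-one operator $x\mapsto\langle v,x\rangle v$. $\mathcal U(\mathcal H)$ is the set of unitary operators on $\mathcal H$, and $A^*$ is the adjoint. *)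

theory Defs
  imports "HOL-Probability.Probability"
begin

text \<open>
  A separable real Hilbert space is a type of class
  \<open>{real_inner, banach, second_countable_topology}\<close>.
  The direct sum of \<open>p\<close> copies of \<open>'h\<close> is \<open>'h ^ 'p\<close>,
  whose inner product is the sum of the componentwise inner products; the index type \<open>'p\<close>
  is finite and linearly ordered and plays the role of \<open>{1..p}\<close>.
\<close>

subsection \<open>Operators\<close>

text \<open>
  Basis and eigenvalue sequences are indexed by an initial segment \<open>K\<close> of the naturals
  (counting from 0). Totality forces \<open>K = UNIV\<close> if the space is infinite-dimensional and
  \<open>K = {..<n}\<close> if it has dimension \<open>n\<close>.
\<close>

definition orthonormal_basis :: "nat set \<Rightarrow> (nat \<Rightarrow> 'h::real_inner) \<Rightarrow> bool" where
  "orthonormal_basis K v \<longleftrightarrow>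
     (K = UNIV \<or> (\<exists>n. K = {..<n})) \<and>
     (\<forall>j\<in>K. \<forall>k\<in>K. v j \<bullet> v k = (if j = k then 1 else 0)) \<and>
     closure (span (v ` K)) = UNIV"

definition unitary :: "('h::real_inner \<Rightarrow> 'h) \<Rightarrow> bool" where
  "unitary U \<longleftrightarrow> orthogonal_transformation U \<and> surj U"

definition positive_operator :: "('h::real_inner \<Rightarrow> 'h) \<Rightarrow> bool" where
  "positive_operator A \<longleftrightarrow>
     bounded_linear A \<and> (\<forall>x y. A x \<bullet> y = x \<bullet> A y) \<and> (\<forall>x. 0 \<le> x \<bullet> A x)"

text \<open>The trace-class condition is only expressed for positive semidefinite operators, where it
  amounts to finiteness of the trace.\<close>

definition covariance_operator :: "('h::real_inner \<Rightarrow> 'h) \<Rightarrow> bool" where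
  "covariance_operator A \<longleftrightarrow>
     positive_operator A \<and>
     (\<forall>K v. orthonormal_basis K v \<longrightarrow> (\<lambda>k. v k \<bullet> A (v k)) summable_on K)"

definition operator_sqrt :: "('h::real_inner \<Rightarrow> 'h) \<Rightarrow> 'h \<Rightarrow> 'h" where
  "operator_sqrt A = (THE B. positive_operator B \<and> B \<circ> B = A)"

definition rank_one :: "'h::real_inner \<Rightarrow> 'h \<Rightarrow> 'h" where
  "rank_one v x = (v \<bullet> x) *\<^sub>R v"

definition diagonal_operator ::
  "nat set \<Rightarrow> (nat \<Rightarrow> 'h::real_inner) \<Rightarrow> (nat \<Rightarrow> real) \<Rightarrow> 'h \<Rightarrow> 'h" where
  "diagonal_operator K v l x = (\<Sum>\<^sub>\<infinity>k\<in>K. l k *\<^sub>R rank_one (v k) x)"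

text \<open>
  \<open>l\<close> lists the eigenvalues of the compact positive semidefinite operator \<open>A\<close> in
  non-increasing order with multiplicity. Only positive eigenvalues need to be counted: the
  remaining entries of \<open>l\<close> are then 0. In finite dimension the number of zeros is
  automatically the dimension of the kernel; in infinite dimension there are infinitely many
  zeros if \<open>A\<close> has finite rank and none otherwise. As \<open>card\<close> is 0 on infinite
  sets, finiteness is required separately.
\<close>

definition eigenvalue_sequence ::
  "nat set \<Rightarrow> ('h::real_inner \<Rightarrow> 'h) \<Rightarrow> (nat \<Rightarrow> real) \<Rightarrow> bool" where
  "eigenvalue_sequence K A l \<longleftrightarrow>
     (\<forall>k\<in>K. 0 \<le> l k) \<and>
     antimono_on K l \<and>
     (\<forall>s>0. finite {k \<in> K. l k = s} \<and> card {k \<in> K. l k = s} = dim {x. A x = s *\<^sub>R x})"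

definition block_operator ::
  "('p::finite \<Rightarrow> 'p \<Rightarrow> 'h::real_inner \<Rightarrow> 'h) \<Rightarrow> 'h ^ 'p \<Rightarrow> 'h ^ 'p" where
  "block_operator B x = (\<chi> i. \<Sum>j\<in>UNIV. B i j (x $ j))"

subsection \<open>Gaussian measures\<close>

definition normal_law :: "real \<Rightarrow> real measure" where
  "normal_law s =
     (if s = 0 then return borel 0
      else density lborel (\<lambda>x. ennreal (normal_density 0 (sqrt s) x)))"

text \<open>\<open>\<mu>\<close> is the centered Gaussian measure with covariance operator \<open>A\<close>:
  every continuous linear functional \<open>h\<close> is normally distributed with mean 0 and variance
  \<open>h \<bullet> A h\<close>.\<close>

definition is_gaussian :: "('h::real_inner \<Rightarrow> 'h) \<Rightarrow> 'h measure \<Rightarrow> bool" where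
  "is_gaussian A \<mu> \<longleftrightarrow>
     covariance_operator A \<and> prob_space \<mu> \<and> sets \<mu> = sets borel \<and>
     (\<forall>h. distr \<mu> borel (\<lambda>x. h \<bullet> x) = normal_law (h \<bullet> A h))"

subsection \<open>The multimarginal inner product Gromov-Wasserstein problem\<close>

definition couplings ::
  "('p::finite \<Rightarrow> 'h::real_inner measure) \<Rightarrow> ('h ^ 'p) measure set" where
  "couplings \<mu> =
     {\<pi>. prob_space \<pi> \<and> sets \<pi> = sets borel \<and> (\<forall>i. distr \<pi> borel (\<lambda>x. x $ i) = \<mu> i)}"

definition igw_cost :: "('h::real_inner, 'p::{finite,linorder}) vec measure \<Rightarrow> ennreal" where
  "igw_cost \<pi> =
     (\<integral>\<^sup>+ (x, x'). ennreal (\<Sum>i\<in>UNIV. \<Sum>j\<in>{i<..}. (x $ i \<bullet> x' $ i - x $ j \<bullet> x' $ j)\<^sup>2)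
        \<partial>(\<pi> \<Otimes>\<^sub>M \<pi>))"

definition solves_multimarginal_igw ::
  "('p::{finite,linorder} \<Rightarrow> 'h::real_inner measure) \<Rightarrow> ('h, 'p) vec measure \<Rightarrow> bool" where
  "solves_multimarginal_igw \<mu> \<pi> \<longleftrightarrow>
     \<pi> \<in> couplings \<mu> \<and> igw_cost \<pi> = (INF \<gamma>\<in>couplings \<mu>. igw_cost \<gamma>)"

end

theory Submission
  imports Defs
begin

text \<open>
  For a coupling \<open>\<gamma>\<close>, expanding the square shows that only the terms
  \<open>- 2 * \<integral> \<langle>x_i, x_i'\<rangle> \<langle>x_j, x_j'\<rangle> d(\<gamma> \<otimes> \<gamma>)\<close> of the cost depend on \<open>\<gamma>\<close>, and each of these integrals is
  the squared Hilbert--Schmidt norm of the cross-covariance of \<open>x_i\<close> and \<open>x_j\<close>. In the eigenbases of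
  the two covariances (eigenvalues \<open>a_k\<close> and \<open>b_m\<close>) the entries \<open>c_km\<close> of the cross-covariance
  satisfy \<open>c_km\<^sup>2 = D_km a_k b_m\<close> where, by Bessel's inequality in the space of square-integrable
  random variables, \<open>D\<close> is doubly substochastic. As both eigenvalue sequences are non-increasing, the
  rearrangement inequality bounds the squared norm by \<open>\<Sum>k. a_k b_k\<close>, and the Gaussian measure of
  the theorem, the law of \<open>\<Sum>k. g_k w_k\<close> with independent standard normal \<open>g_k\<close> and
  \<open>w_k = (sqrt (a_ik) Q_i v_k)_i\<close>, attains all these bounds simultaneously.
\<close>

text \<open>\<open>is_gaussian\<close> speaks only of the laws of single functionals. Uniqueness of
  the block Gaussian and the identification of its marginals therefore rest on a Cramer-Wold theorem
  in Hilbert space, obtained from one-dimensional Levy uniqueness by trading cosine test functions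
  for indicators, one direction at a time. The bounds for different pairs are attained together
  because one scalar noise g_k drives the k-th eigendirection of all components. Every
  cross-covariance is then diagonal in the eigenbases, with entries sqrt (a_ik a_jk), so D_km is 1
  if k = m and both eigenvalues are positive, and 0 otherwise: the extreme case of the rearrangement
  inequality. Covariances are compared on N by N truncations, so that the rearrangement stays
  finite; the squared Hilbert--Schmidt norms appear as limits in N. Degenerate cases are absorbed by
  conventions: padding vectors are zero with eigenvalue 0, and division by zero makes the entries of
  D at zero eigenvalues 0.\<close>

text \<open>Boxes with sides in a countable basis form a countable basis. The instance lets the
  results on measures over a second countable Hilbert space apply to the direct sum
  \<open>'h ^ 'p\<close>.\<close>

instance vec :: ("{metric_space, second_countable_topology}", finite) second_countable_topology
proof
  obtain C :: "'a set set" where C: "countable C" "topological_basis C"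
    using ex_countable_basis by blast
  define D :: "('a ^ 'b) set set" where
    "D = (\<lambda>A. {x. \<forall>i. x $ i \<in> A i}) ` (UNIV \<rightarrow>\<^sub>E C)"
  have "countable D"
    unfolding D_def by (intro countable_image countable_PiE) (use C in auto)
  moreover have "topological_basis D"
  proof (rule topological_basisI)
    fix S :: "('a ^ 'b) set" assume "S \<in> D"
    then obtain A where "A \<in> UNIV \<rightarrow>\<^sub>E C" and S: "S = {x. \<forall>i. x $ i \<in> A i}"
      unfolding D_def by blast
    then have A: "A i \<in> C" for i
      by auto
    from S have "S = (\<Inter>i. (\<lambda>x. x $ i) -` A i)"
      by auto
    then show "open S"
      using A C(2) by (auto intro!: open_INT open_vimage_vec_nth simp: topological_basis_open)
  next
    fix S :: "('a ^ 'b) set" and x assume "open S" "x \<in> S"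
    then obtain A where A: "\<And>i. open (A i)" "\<And>i. x $ i \<in> A i"
        "\<And>y. (\<forall>i. y $ i \<in> A i) \<Longrightarrow> y \<in> S"
      unfolding open_vec_def by meson
    have "\<exists>c\<in>C. x $ i \<in> c \<and> c \<subseteq> A i" for i
      using topological_basisE[OF C(2) A(1) A(2)] by metis
    then obtain c where c: "\<And>i. c i \<in> C" "\<And>i. x $ i \<in> c i" "\<And>i. c i \<subseteq> A i"
      by metis
    have "{x. \<forall>i. x $ i \<in> c i} \<in> D"
      unfolding D_def using c by auto
    then show "\<exists>T\<in>D. x \<in> T \<and> T \<subseteq> S"
      using c A(3) by (intro bexI[of _ "{x. \<forall>i. x $ i \<in> c i}"]) blast+
  qed
  ultimately show "\<exists>B::('a ^ 'b) set set. countable B \<and> open = generate_topology B"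
    using topological_basis_imp_subbasis by blast
qed

subsection \<open>Measures on Hilbert spaces are determined by their one-dimensional projections\<close>

text \<open>Weak measurability implies measurability in a separable space: a closed ball is a
  countable intersection of half-spaces with normals in a dense set, and by Lindelof an open set is
  a countable union of open balls.\<close>

lemma borel_measurable_if_inner:
  fixes f :: "'b \<Rightarrow> 'a::{real_inner, second_countable_topology}"
  assumes f: "\<And>h. (\<lambda>x. h \<bullet> f x) \<in> borel_measurable M"
  shows "f \<in> borel_measurable M"
proof -
  obtain D :: "'a set" where D: "countable D" "\<And>U. open U \<Longrightarrow> U \<noteq> {} \<Longrightarrow> \<exists>d\<in>D. d \<in> U"
    using countable_dense_exists[where ?'a = 'a] by auto
  have norm_le: "norm y \<le> r \<longleftrightarrow> (\<forall>d\<in>D. d \<bullet> y \<le> r * norm d)" if "0 \<le> r" for y :: 'a and r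
  proof
    assume "norm y \<le> r"
    show "\<forall>d\<in>D. d \<bullet> y \<le> r * norm d"
    proof
      fix d
      have "d \<bullet> y \<le> norm d * norm y" by (rule norm_cauchy_schwarz)
      also have "\<dots> \<le> r * norm d"
        using mult_right_mono[OF \<open>norm y \<le> r\<close> norm_ge_zero[of d]] by (simp add: mult.commute)
      finally show "d \<bullet> y \<le> r * norm d" .
    qed
  next
    assume *: "\<forall>d\<in>D. d \<bullet> y \<le> r * norm d"
    \<comment> \<open>The inequality is a closed condition on \<open>d\<close>, so it extends from
      the dense set \<open>D\<close> to every vector; \<open>d = y\<close> then bounds the
      norm.\<close>
    have "closed {d. d \<bullet> y \<le> r * norm d}"
      by (intro closed_Collect_le continuous_intros)
    then have "open (- {d. d \<bullet> y \<le> r * norm d})"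
      by (rule open_Compl)
    with D(2) * have "- {d. d \<bullet> y \<le> r * norm d} = {}"
      by blast
    then have "y \<bullet> y \<le> r * norm y"
      by auto
    then have "norm y * norm y \<le> r * norm y"
      by (simp add: dot_square_norm power2_eq_square)
    then show "norm y \<le> r"
      using \<open>0 \<le> r\<close> by (cases "y = 0") auto
  qed
  have norm_meas: "(\<lambda>x. norm (f x - a)) \<in> borel_measurable M" for a
    unfolding borel_measurable_iff_le
  proof
    fix r :: real
    show "{w \<in> space M. norm (f w - a) \<le> r} \<in> sets M"
    proof (cases "0 \<le> r")
      case True
      have meas: "(\<lambda>x. d \<bullet> (f x - a)) \<in> borel_measurable M" for d
        unfolding inner_diff_right using f by measurable
      have "D \<noteq> {}"
        using D(2)[of UNIV] by auto
      then have "{w \<in> space M. \<forall>d\<in>D. d \<bullet> (f w - a) \<le> r * norm d} =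
          (\<Inter>d\<in>D. {w \<in> space M. d \<bullet> (f w - a) \<le> r * norm d})"
        by auto
      also have "\<dots> \<in> sets M"
        using meas \<open>D \<noteq> {}\<close> by (intro sets.countable_INT' D(1)) auto
      finally have "{w \<in> space M. \<forall>d\<in>D. d \<bullet> (f w - a) \<le> r * norm d} \<in> sets M" .
      then show ?thesis
        by (simp only: norm_le[OF True])
    next
      case False
      then have "{w \<in> space M. norm (f w - a) \<le> r} = {}"
        using norm_ge_zero order_trans by blast
      then show ?thesis by (simp only: sets.empty_sets)
    qed
  qed
  show ?thesis
  proof (rule borel_measurableI)
    fix S :: "'a set" assume "open S"
    define F where "F = {ball a r |a r. ball a r \<subseteq> S}"
    have "\<And>B. B \<in> F \<Longrightarrow> open B"
      unfolding F_def by auto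
    from Lindelof[OF this] obtain G where G: "G \<subseteq> F" "countable G" "\<Union>G = \<Union>F"
      by blast
    have "\<Union>F = S"
    proof
      show "S \<subseteq> \<Union>F"
      proof
        fix x assume "x \<in> S"
        then obtain r where "0 < r" "ball x r \<subseteq> S"
          using \<open>open S\<close> open_contains_ball by blast
        then show "x \<in> \<Union>F"
          unfolding F_def using centre_in_ball by blast
      qed
    qed (auto simp: F_def)
    then have GS: "S = \<Union>G"
      using G(3) by simp
    have S: "f -` S \<inter> space M = (\<Union>B\<in>G. f -` B \<inter> space M)"
      unfolding GS by blast
    have "f -` B \<inter> space M \<in> sets M" if B: "B \<in> G" for B
    proof -
      obtain a r where "B = ball a r" using B G(1) unfolding F_def by auto
      then have "f -` B \<inter> space M = {x \<in> space M. norm (f x - a) < r}"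
        by (auto simp: dist_norm norm_minus_commute)
      also have "\<dots> \<in> sets M"
        using norm_meas[of a] unfolding borel_measurable_iff_less by blast
      finally show ?thesis .
    qed
    then show "f -` S \<inter> space M \<in> sets M"
      unfolding S using G(2) by (intro sets.countable_UN') auto
  qed
qed

lemma measurable_inner_const:
  fixes M :: "'a::real_inner measure"
  assumes "sets M = sets borel"
  shows "(\<lambda>x. h \<bullet> x) \<in> borel_measurable M"
proof -
  have "(\<lambda>x. h \<bullet> x) \<in> borel_measurable borel"
    by (intro borel_measurable_continuous_onI continuous_intros)
  then show ?thesis
    using assms measurable_cong_sets by blast
qed

section \<open>Fourier uniqueness, lifted from the line to Hilbert space\<close>

text \<open>Phase 0 gives the real part of the characteristic function and phase - pi / 2 the
  imaginary part. Cosines with a free phase keep all test functions real and are closed, up to sums,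
  under products.\<close>

lemma (in prob_space) distr_eqI_cos:
  fixes X :: "'a \<Rightarrow> real" and Y :: "'b \<Rightarrow> real"
  assumes "prob_space N"
    and X [measurable]: "X \<in> borel_measurable M" and Y [measurable]: "Y \<in> borel_measurable N"
    and eq: "\<And>s \<phi>. (\<integral>x. cos (s * X x + \<phi>) \<partial>M) = (\<integral>x. cos (s * Y x + \<phi>) \<partial>N)"
  shows "distr M borel X = distr N borel Y"
proof (rule Levy_uniqueness)
  interpret N: prob_space N by fact
  show "real_distribution (distr M borel X)" "real_distribution (distr N borel Y)"
    by simp_all
  show "char (distr M borel X) = char (distr N borel Y)"
  proof
    fix s
    have iM: "integrable M (\<lambda>x. iexp (s * X x))"
      by (rule integrable_const_bound[of _ 1]) auto
    have iN: "integrable N (\<lambda>x. iexp (s * Y x))"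
      by (rule N.integrable_const_bound[of _ 1]) auto
    have char: "char (distr M borel X) s = (\<integral>x. iexp (s * X x) \<partial>M)"
      "char (distr N borel Y) s = (\<integral>x. iexp (s * Y x) \<partial>N)"
      by (simp_all add: char_def integral_distr)
    have "Re (char (distr M borel X) s) = Re (char (distr N borel Y) s)"
      unfolding char integral_Re[OF iM, symmetric] integral_Re[OF iN, symmetric]
      using eq[of s 0] by (simp add: Re_exp)
    moreover have "cos (y + - (pi / 2)) = sin y" for y :: real
      by (simp add: cos_diff)
    then have "Im (char (distr M borel X) s) = Im (char (distr N borel Y) s)"
      unfolding char integral_Im[OF iM, symmetric] integral_Im[OF iN, symmetric]
      using eq[of s "- (pi / 2)"] by (simp add: Im_exp)
    ultimately show "char (distr M borel X) s = char (distr N borel Y) s"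
      by (rule complex_eqI)
  qed
qed

text \<open>\<open>eq\<close> at \<open>s = 0\<close> and phase 0 shows that both weights have the
  same total mass \<open>c\<close>. If \<open>c\<close> is positive, \<open>u / c\<close> and
  \<open>w / c\<close> are probability densities, and \<open>eq\<close> says that \<open>X\<close>
  and \<open>Y\<close> have equal cosine transforms under the reweighted measures. If
  \<open>c = 0\<close>, both weights vanish almost everywhere.\<close>

lemma weighted_indicator_integral_eqI:
  fixes X :: "'a \<Rightarrow> real" and Y :: "'b \<Rightarrow> real"
  assumes M: "prob_space M" and N: "prob_space N"
    and X [measurable]: "X \<in> borel_measurable M" and Y [measurable]: "Y \<in> borel_measurable N"
    and u [measurable]: "u \<in> borel_measurable M" and w [measurable]: "w \<in> borel_measurable N"
    and u_bd: "\<And>x. 0 \<le> u x \<and> u x \<le> C" and w_bd: "\<And>x. 0 \<le> w x \<and> w x \<le> C"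
    and eq: "\<And>s \<phi>. (\<integral>x. u x * cos (s * X x + \<phi>) \<partial>M) = (\<integral>x. w x * cos (s * Y x + \<phi>) \<partial>N)"
    and B [measurable]: "B \<in> sets borel"
  shows "(\<integral>x. u x * indicator B (X x) \<partial>M) = (\<integral>x. w x * indicator B (Y x) \<partial>N)"
proof -
  interpret M: prob_space M by fact
  interpret N: prob_space N by fact
  have iu: "integrable M u" and iw: "integrable N w"
    using u_bd w_bd by (auto intro!: M.integrable_const_bound[of _ C] N.integrable_const_bound[of _ C])
  define c where "c = (\<integral>x. u x \<partial>M)"
  have c': "c = (\<integral>x. w x \<partial>N)"
    using eq[of 0 0] by (simp add: c_def)
  have "0 \<le> c" unfolding c_def using u_bd by simp
  show ?thesis
  proof (cases "c = 0")
    case True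
    then have "AE x in M. u x = 0" "AE x in N. w x = 0"
      using integral_nonneg_eq_0_iff_AE[OF iu] integral_nonneg_eq_0_iff_AE[OF iw] u_bd w_bd c' c_def
      by auto
    then have "(\<integral>x. u x * indicator B (X x) \<partial>M) = 0" "(\<integral>x. w x * indicator B (Y x) \<partial>N) = 0"
      by (auto intro!: integral_eq_zero_AE)
    then show ?thesis by simp
  next
    case False
    with \<open>0 \<le> c\<close> have c: "0 < c" by simp
    define M' where "M' = density M (\<lambda>x. ennreal (u x / c))"
    define N' where "N' = density N (\<lambda>x. ennreal (w x / c))"
    have intM: "(\<integral>x. f x \<partial>M') = (\<integral>x. u x * f x \<partial>M) / c" if [measurable]: "f \<in> borel_measurable M" for f
      unfolding M'_def using u_bd c by (subst integral_density) auto
    have intN: "(\<integral>x. f x \<partial>N') = (\<integral>x. w x * f x \<partial>N) / c" if [measurable]: "f \<in> borel_measurable N" for f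
      unfolding N'_def using w_bd c by (subst integral_density) auto
    have pM: "prob_space M'"
    proof
      have "emeasure M' (space M') = (\<integral>\<^sup>+x. ennreal (u x / c) \<partial>M)"
        unfolding M'_def by (simp add: emeasure_density cong: nn_integral_cong)
      also have "\<dots> = ennreal (\<integral>x. u x / c \<partial>M)"
        using iu u_bd c by (intro nn_integral_eq_integral) auto
      also have "\<dots> = 1"
        using c by (simp add: c_def)
      finally show "emeasure M' (space M') = 1" .
    qed
    have pN: "prob_space N'"
    proof
      have "emeasure N' (space N') = (\<integral>\<^sup>+x. ennreal (w x / c) \<partial>N)"
        unfolding N'_def by (simp add: emeasure_density cong: nn_integral_cong)
      also have "\<dots> = ennreal (\<integral>x. w x / c \<partial>N)"
        using iw w_bd c by (intro nn_integral_eq_integral) auto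
      also have "\<dots> = 1"
        using c by (simp add: c')
      finally show "emeasure N' (space N') = 1" .
    qed
    have [measurable]: "X \<in> borel_measurable M'" "Y \<in> borel_measurable N'"
      using X Y by (simp_all add: M'_def N'_def)
    have "distr M' borel X = distr N' borel Y"
      by (rule prob_space.distr_eqI_cos[OF pM pN]) (simp_all add: intM intN eq)
    then have "(\<integral>x. indicator B x \<partial>distr M' borel X) = (\<integral>x. indicator B x \<partial>distr N' borel Y :: real)"
      by simp
    moreover have "(\<integral>x. indicator B x \<partial>distr M' borel X :: real) = (\<integral>x. indicator B (X x) \<partial>M')"
      by (rule integral_distr) auto
    moreover have "(\<integral>x. indicator B x \<partial>distr N' borel Y :: real) = (\<integral>x. indicator B (Y x) \<partial>N')"
      by (rule integral_distr) auto
    ultimately have "(\<integral>x. indicator B (X x) \<partial>M') = (\<integral>x. indicator B (Y x) \<partial>N' :: real)"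
      by simp
    then show ?thesis
      using c by (simp add: intM intN)
  qed
qed

lemma sets_cylinder:
  fixes L :: "'a::real_inner measure"
  assumes L: "sets L = sets borel" and B: "\<And>h B. (h, B) \<in> set hs \<Longrightarrow> B \<in> sets borel"
  shows "{x. \<forall>(h, B)\<in>set hs. h \<bullet> x \<in> B} \<in> sets L"
proof -
  have "space L = UNIV"
    using sets_eq_imp_space_eq[OF L] by simp
  then have "{x. \<forall>(h, B)\<in>set hs. h \<bullet> x \<in> B} = {x \<in> space L. \<forall>k\<in>set hs. fst k \<bullet> x \<in> snd k}"
    by auto
  also have "\<dots> \<in> sets L"
    by (intro sets.sets_Collect_finite_All measurable_sets_Collect[OF measurable_inner_const[OF L]])
      (auto intro: B)
  finally show ?thesis .
qed

text \<open>The cosine factor is what makes the induction work. With an empty list only the law of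
  one functional is involved. To add a condition on \<open>h\<close>, the product of the cosines for
  \<open>s *\<^sub>R h\<close> and \<open>g\<close> is split into cosines for their sum and
  difference, which the induction hypothesis covers as \<open>g\<close> is arbitrary there;
  one-dimensional uniqueness then replaces the cosine in \<open>h\<close> by the indicator of
  \<open>B\<close>.\<close>

lemma cylinder_cos_integral_eq:
  fixes M N :: "'a::real_inner measure"
  assumes M: "prob_space M" and N: "prob_space N"
    and sM: "sets M = sets borel" and sN: "sets N = sets borel"
    and proj: "\<And>h. distr M borel (\<lambda>x. h \<bullet> x) = distr N borel (\<lambda>x. h \<bullet> x)"
    and cyl: "\<And>h B. (h, B) \<in> set hs \<Longrightarrow> B \<in> sets borel"
  shows "(\<integral>x. indicator {x. \<forall>(h, B)\<in>set hs. h \<bullet> x \<in> B} x * cos (g \<bullet> x + \<theta>) \<partial>M) =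
         (\<integral>x. indicator {x. \<forall>(h, B)\<in>set hs. h \<bullet> x \<in> B} x * cos (g \<bullet> x + \<theta>) \<partial>N)"
  using cyl
proof (induction hs arbitrary: g \<theta>)
  case Nil
  note [measurable] = measurable_inner_const[OF sM] measurable_inner_const[OF sN]
  have "(\<integral>y. cos (y + \<theta>) \<partial>distr M borel (\<lambda>x. g \<bullet> x)) = (\<integral>y. cos (y + \<theta>) \<partial>distr N borel (\<lambda>x. g \<bullet> x))"
    by (simp only: proj)
  then show ?case
    by (simp add: integral_distr)
next
  case (Cons k hs)
  interpret M: prob_space M by fact
  interpret N: prob_space N by fact
  note [measurable] = measurable_inner_const[OF sM] measurable_inner_const[OF sN]
  obtain h B where k: "k = (h, B)" by force
  have B [measurable]: "B \<in> sets borel"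
    using Cons.prems k by auto
  have IH: "\<And>g \<theta>. (\<integral>x. indicator {x. \<forall>(h, B)\<in>set hs. h \<bullet> x \<in> B} x * cos (g \<bullet> x + \<theta>) \<partial>M) =
         (\<integral>x. indicator {x. \<forall>(h, B)\<in>set hs. h \<bullet> x \<in> B} x * cos (g \<bullet> x + \<theta>) \<partial>N)"
    using Cons by auto
  define I :: "'a \<Rightarrow> real" where "I = indicator {x. \<forall>(h, B)\<in>set hs. h \<bullet> x \<in> B}"
  have meas_I: "I \<in> borel_measurable L" if L: "sets L = sets borel" for L
    unfolding I_def using Cons.prems
    by (intro borel_measurable_indicator sets_cylinder[OF L]) auto
  note [measurable] = meas_I[OF sM] meas_I[OF sN]
  have I: "0 \<le> I x" "I x \<le> 1" for x
    by (auto simp: I_def indicator_def)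
  have bd: "\<bar>I x * cos y\<bar> \<le> 1" for x y
    using mult_mono[of "I x" 1 "\<bar>cos y\<bar>" 1] I[of x] by (simp add: abs_mult)
  have intM: "integrable M (\<lambda>x. I x * cos (g \<bullet> x + \<theta>))" for g \<theta>
    using bd by (intro M.integrable_const_bound[of _ 1]) auto
  have intN: "integrable N (\<lambda>x. I x * cos (g \<bullet> x + \<theta>))" for g \<theta>
    using bd by (intro N.integrable_const_bound[of _ 1]) auto
  have plain: "(\<integral>x. I x * indicator B (h \<bullet> x) \<partial>M) = (\<integral>x. I x * indicator B (h \<bullet> x) \<partial>N)"
  proof (rule weighted_indicator_integral_eqI[OF M N, where C = 1])
    show "(\<integral>x. I x * cos (s * (h \<bullet> x) + \<phi>) \<partial>M) = (\<integral>x. I x * cos (s * (h \<bullet> x) + \<phi>) \<partial>N)" for s \<phi>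
      using IH[of "s *\<^sub>R h" \<phi>] by (simp add: I_def)
  qed (use I in auto)
  \<comment> \<open>The constant 1 makes the weight nonnegative, so that the uniqueness theorem for characteristic
    functions of probability measures applies; its contribution is removed with \<open>plain\<close>.\<close>
  have "(\<integral>x. (I x * (1 + cos (g \<bullet> x + \<theta>))) * indicator B (h \<bullet> x) \<partial>M) =
        (\<integral>x. (I x * (1 + cos (g \<bullet> x + \<theta>))) * indicator B (h \<bullet> x) \<partial>N)"
  proof (rule weighted_indicator_integral_eqI[OF M N, where C = 2])
    fix s \<phi>
    have expand: "I x * (1 + cos (g \<bullet> x + \<theta>)) * cos (s * (h \<bullet> x) + \<phi>) =
        I x * cos ((s *\<^sub>R h) \<bullet> x + \<phi>)
        + (1/2) * (I x * cos ((s *\<^sub>R h + g) \<bullet> x + (\<phi> + \<theta>)))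
        + (1/2) * (I x * cos ((s *\<^sub>R h - g) \<bullet> x + (\<phi> - \<theta>)))" for x
    proof -
      have "r * (1 + cos A) * cos C = r * cos C + (1/2) * (r * cos (C + A)) + (1/2) * (r * cos (C - A))"
        for r A C :: real
        by (simp add: cos_add cos_diff field_simps)
      moreover have "(s *\<^sub>R h) \<bullet> x + \<phi> = s * (h \<bullet> x) + \<phi>"
        "(s *\<^sub>R h + g) \<bullet> x + (\<phi> + \<theta>) = (s * (h \<bullet> x) + \<phi>) + (g \<bullet> x + \<theta>)"
        "(s *\<^sub>R h - g) \<bullet> x + (\<phi> - \<theta>) = (s * (h \<bullet> x) + \<phi>) - (g \<bullet> x + \<theta>)"
        by (simp_all add: inner_add_left inner_diff_left)
      ultimately show ?thesis
        by (simp only:)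
    qed
    show "(\<integral>x. I x * (1 + cos (g \<bullet> x + \<theta>)) * cos (s * (h \<bullet> x) + \<phi>) \<partial>M) =
          (\<integral>x. I x * (1 + cos (g \<bullet> x + \<theta>)) * cos (s * (h \<bullet> x) + \<phi>) \<partial>N)"
      unfolding expand by (simp add: intM intN IH[folded I_def] del: inner_scaleR_left)
  next
    fix x
    have "0 \<le> 1 + cos (g \<bullet> x + \<theta>)" "1 + cos (g \<bullet> x + \<theta>) \<le> 2"
      using cos_ge_minus_one[of "g \<bullet> x + \<theta>"] cos_le_one[of "g \<bullet> x + \<theta>"] by linarith+
    then show "0 \<le> I x * (1 + cos (g \<bullet> x + \<theta>)) \<and> I x * (1 + cos (g \<bullet> x + \<theta>)) \<le> 2"
      and "0 \<le> I x * (1 + cos (g \<bullet> x + \<theta>)) \<and> I x * (1 + cos (g \<bullet> x + \<theta>)) \<le> 2"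
      using I[of x] mult_mono[of "I x" 1 "1 + cos (g \<bullet> x + \<theta>)" 2] by auto
  qed auto
  moreover have "I x * (1 + cos (g \<bullet> x + \<theta>)) * indicator B (h \<bullet> x) =
      I x * indicator B (h \<bullet> x) + I x * indicator B (h \<bullet> x) * cos (g \<bullet> x + \<theta>)" for x
    by (simp add: algebra_simps)
  moreover have bd2: "\<bar>I x * indicator B (h \<bullet> x)\<bar> \<le> 1" "\<bar>I x * indicator B (h \<bullet> x) * cos y\<bar> \<le> 1" for x y
    using I[of x] bd[of x y] by (auto simp: indicator_def)
  moreover have "integrable M (\<lambda>x. I x * indicator B (h \<bullet> x))"
    "integrable N (\<lambda>x. I x * indicator B (h \<bullet> x))"
    "integrable M (\<lambda>x. I x * indicator B (h \<bullet> x) * cos (g \<bullet> x + \<theta>))"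
    "integrable N (\<lambda>x. I x * indicator B (h \<bullet> x) * cos (g \<bullet> x + \<theta>))"
    using bd2 by (auto intro!: M.integrable_const_bound[of _ 1] N.integrable_const_bound[of _ 1])
  ultimately have "(\<integral>x. I x * indicator B (h \<bullet> x) * cos (g \<bullet> x + \<theta>) \<partial>M) =
      (\<integral>x. I x * indicator B (h \<bullet> x) * cos (g \<bullet> x + \<theta>) \<partial>N)"
    using plain by simp
  moreover have "indicator {x. \<forall>(h, B)\<in>set (k # hs). h \<bullet> x \<in> B} x = I x * indicator B (h \<bullet> x)" for x
    by (auto simp: I_def k indicator_def)
  ultimately show ?case
    by (simp only:)
qed

text \<open>A Cramer-Wold theorem: cylinders are stable under intersection, as their lists can be
  appended, and they generate the Borel sets.\<close>

theorem measure_eqI_projections: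
  fixes M N :: "'a::{real_inner, second_countable_topology} measure"
  assumes M: "prob_space M" and N: "prob_space N"
    and sM: "sets M = sets borel" and sN: "sets N = sets borel"
    and proj: "\<And>h. distr M borel (\<lambda>x. h \<bullet> x) = distr N borel (\<lambda>x. h \<bullet> x)"
  shows "M = N"
proof -
  interpret M: prob_space M by fact
  interpret N: prob_space N by fact
  define cyl :: "('a \<times> real set) list \<Rightarrow> 'a set"
    where "cyl hs = {x. \<forall>(h, B)\<in>set hs. h \<bullet> x \<in> B}" for hs
  define E where "E = cyl ` {hs. \<forall>(h, B)\<in>set hs. B \<in> sets borel}"
  have sp: "space M = UNIV" "space N = UNIV"
    using sets_eq_imp_space_eq[OF sM] sets_eq_imp_space_eq[OF sN] by simp_all
  have cyl_borel: "cyl hs \<in> sets borel" if "\<forall>(h, B)\<in>set hs. B \<in> sets borel" for hs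
    unfolding cyl_def using that by (intro sets_cylinder) auto
  have "Int_stable E"
  proof (rule Int_stableI)
    fix a b assume "a \<in> E" "b \<in> E"
    then obtain hs hs' where *: "a = cyl hs" "b = cyl hs'"
      "\<forall>(h, B)\<in>set hs. B \<in> sets borel" "\<forall>(h, B)\<in>set hs'. B \<in> sets borel"
      unfolding E_def by auto
    then have "a \<inter> b = cyl (hs @ hs')"
      unfolding cyl_def by auto
    then show "a \<inter> b \<in> E"
      unfolding E_def using * by (intro image_eqI[of _ _ "hs @ hs'"]) auto
  qed
  moreover have "emeasure M X = emeasure N X" if "X \<in> E" for X
  proof -
    obtain hs where hs: "X = cyl hs" "\<forall>(h, B)\<in>set hs. B \<in> sets borel"
      using \<open>X \<in> E\<close> unfolding E_def by blast
    \<comment> \<open>Frequency 0 and phase 0 turn the cosine into the constant 1.\<close>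
    have "(\<integral>x. indicator X x \<partial>M :: real) = (\<integral>x. indicator X x \<partial>N)"
      using cylinder_cos_integral_eq[OF M N sM sN proj, of hs 0 0] hs by (auto simp: cyl_def)
    moreover have "X \<in> sets M" "X \<in> sets N"
      using cyl_borel[OF hs(2)] hs(1) sM sN by simp_all
    ultimately show ?thesis
      by (simp add: M.emeasure_eq_measure N.emeasure_eq_measure)
  qed
  moreover have "sets (borel :: 'a measure) = sigma_sets UNIV E"
  proof
    show "sigma_sets UNIV E \<subseteq> sets borel"
      using cyl_borel sets.sigma_sets_subset[of E "borel :: 'a measure"] unfolding E_def by auto
    define S where "S = sigma (UNIV :: 'a set) E"
    have S: "sets S = sigma_sets UNIV E" "space S = UNIV"
      by (simp_all add: S_def)
    \<comment> \<open>Borel sets lie in the cylinder sigma-algebra because the identity on it is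
      weakly, hence Borel, measurable.\<close>
    have "(\<lambda>x. x) \<in> borel_measurable S"
    proof (rule borel_measurable_if_inner, rule measurableI)
      fix h :: 'a and B :: "real set" assume "B \<in> sets borel"
      then have "cyl [(h, B)] \<in> E"
        unfolding E_def by auto
      then show "(\<lambda>x. h \<bullet> x) -` B \<inter> space S \<in> sets S"
        by (auto simp: S cyl_def vimage_def)
    qed auto
    then show "sets borel \<subseteq> sigma_sets UNIV E"
      using measurable_sets[of "\<lambda>x. x" S borel] by (auto simp: S)
  qed
  moreover have "cyl [] \<in> E" "cyl [] = UNIV"
    unfolding E_def by (auto simp: cyl_def intro: image_eqI[of _ _ "[]"])
  ultimately show ?thesis
    using sM sN by (intro measure_eqI_generator_eq[of E UNIV M N "\<lambda>_. UNIV"]) auto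
qed

subsection \<open>Orthonormal expansions\<close>

text \<open>A finite orthonormal basis is padded with zero vectors, so that expansions are always series
  indexed by all natural numbers.\<close>

locale padded_basis =
  fixes e :: "nat \<Rightarrow> 'a::real_inner"
  assumes orth: "j \<noteq> k \<Longrightarrow> e j \<bullet> e k = 0"
    and unit: "e k \<noteq> 0 \<Longrightarrow> e k \<bullet> e k = 1"
    and total: "closure (span (range e)) = UNIV"
begin

lemma inner_basis: "e j \<bullet> e k = (if j = k \<and> e k \<noteq> 0 then 1 else 0)"
  using orth[of j k] unit[of k] by auto

lemma norm_diff_partial_sum:
  assumes "finite F"
  shows "(norm (x - (\<Sum>k\<in>F. (e k \<bullet> x) *\<^sub>R e k)))\<^sup>2 = (norm x)\<^sup>2 - (\<Sum>k\<in>F. (e k \<bullet> x)\<^sup>2)"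
proof -
  define S where "S = (\<Sum>k\<in>F. (e k \<bullet> x) *\<^sub>R e k)"
  have eS: "e j \<bullet> S = (if j \<in> F then e j \<bullet> x else 0)" for j
  proof -
    have "e j \<bullet> S = (\<Sum>k\<in>F. if k = j then e j \<bullet> x else 0)"
      unfolding S_def inner_sum_right by (intro sum.cong) (auto simp: inner_basis)
    then show ?thesis using assms by simp
  qed
  have "S \<bullet> x = (\<Sum>k\<in>F. (e k \<bullet> x)\<^sup>2)"
    unfolding S_def inner_sum_left by (simp add: power2_eq_square)
  moreover have "S \<bullet> S = (\<Sum>k\<in>F. (e k \<bullet> x) * (e k \<bullet> S))"
    by (subst S_def) (simp add: inner_sum_left)
  then have "S \<bullet> S = (\<Sum>k\<in>F. (e k \<bullet> x)\<^sup>2)"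
    by (simp add: eS power2_eq_square)
  ultimately show ?thesis
    unfolding S_def[symmetric] power2_norm_eq_inner
    by (simp add: inner_diff_left inner_diff_right inner_commute[of x S])
qed

lemma bessel: "finite F \<Longrightarrow> (\<Sum>k\<in>F. (e k \<bullet> x)\<^sup>2) \<le> (norm x)\<^sup>2"
  using norm_diff_partial_sum[of F x] zero_le_power2[of "norm (x - (\<Sum>k\<in>F. (e k \<bullet> x) *\<^sub>R e k))"]
  by linarith

text \<open>On finite linear combinations the expansion is eventually exact, which leaves a density
  argument for \<open>expansion\<close>.\<close>

lemma partial_sum_span:
  assumes "y \<in> span (range e)"
  shows "\<exists>N. \<forall>n\<ge>N. (\<Sum>k<n. (e k \<bullet> y) *\<^sub>R e k) = y"
  using assms
proof (induction rule: span_induct_alt)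
  case base
  show ?case by simp
next
  case (step c b y)
  then obtain N j where N: "\<And>n. n \<ge> N \<Longrightarrow> (\<Sum>k<n. (e k \<bullet> y) *\<^sub>R e k) = y" and b: "b = e j"
    by auto
  have "(\<Sum>k<n. (e k \<bullet> (c *\<^sub>R b + y)) *\<^sub>R e k) = c *\<^sub>R b + y" if "n \<ge> max N (Suc j)" for n
  proof -
    have "(\<Sum>k<n. (e k \<bullet> (c *\<^sub>R b + y)) *\<^sub>R e k) =
        (\<Sum>k<n. if k = j then c *\<^sub>R b else 0) + (\<Sum>k<n. (e k \<bullet> y) *\<^sub>R e k)"
      unfolding sum.distrib[symmetric]
      by (intro sum.cong) (auto simp: b inner_add_right inner_basis scaleR_add_left)
    also have "\<dots> = c *\<^sub>R b + y"
      using that N[of n] by simp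
    finally show ?thesis .
  qed
  then show ?case by blast
qed

lemma expansion: "(\<lambda>k. (e k \<bullet> x) *\<^sub>R e k) sums x"
  unfolding sums_def
proof (rule LIMSEQ_I)
  fix r :: real assume "0 < r"
  then obtain y where y: "y \<in> span (range e)" "dist y x < r"
    using total closure_approachable[of x "span (range e)"] by auto
  obtain N where N: "\<And>n. n \<ge> N \<Longrightarrow> (\<Sum>k<n. (e k \<bullet> y) *\<^sub>R e k) = y"
    using partial_sum_span[OF y(1)] by auto
  have "norm ((\<Sum>k<n. (e k \<bullet> x) *\<^sub>R e k) - x) < r" if "n \<ge> N" for n
  proof -
    let ?z = "x - y"
    \<comment> \<open>The partial sums reproduce \<open>y\<close>, so \<open>x\<close> and
      \<open>x - y\<close> leave the same residual, and by Pythagoras a residual is no longer than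
      the vector itself.\<close>
    have "x - (\<Sum>k<n. (e k \<bullet> x) *\<^sub>R e k) = ?z - (\<Sum>k<n. (e k \<bullet> ?z) *\<^sub>R e k)"
      using N[OF that] by (simp add: inner_diff_right scaleR_diff_left sum_subtractf)
    then have "(norm (x - (\<Sum>k<n. (e k \<bullet> x) *\<^sub>R e k)))\<^sup>2 \<le> (norm ?z)\<^sup>2"
      by (simp only: norm_diff_partial_sum[OF finite_lessThan]) (simp add: sum_nonneg)
    then have "norm (x - (\<Sum>k<n. (e k \<bullet> x) *\<^sub>R e k)) \<le> norm ?z"
      by (rule power2_le_imp_le) simp
    also have "\<dots> < r"
      using y(2) by (simp add: dist_norm norm_minus_commute)
    finally show ?thesis
      by (simp add: norm_minus_commute)
  qed
  then show "\<exists>no. \<forall>n\<ge>no. norm ((\<Sum>k<n. (e k \<bullet> x) *\<^sub>R e k) - x) < r"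
    by blast
qed

lemma parseval: "(\<lambda>k. (e k \<bullet> x) * (e k \<bullet> y)) sums (x \<bullet> y)"
proof -
  have "(\<lambda>k. ((e k \<bullet> x) *\<^sub>R e k) \<bullet> y) sums (x \<bullet> y)"
    by (intro bounded_linear.sums[OF bounded_linear_inner_left] expansion)
  then show ?thesis by simp
qed

lemma parseval_norm: "(\<lambda>k. (e k \<bullet> x)\<^sup>2) sums (norm x)\<^sup>2"
  using parseval[of x x] by (simp add: power2_eq_square dot_square_norm)

lemma eq_if_inner_basis_eq: "(\<And>k. e k \<bullet> x = e k \<bullet> y) \<Longrightarrow> x = y"
  using expansion[of x] expansion[of y] sums_unique2 by auto

end

lemma padded_basis_if_orthonormal_basis:
  assumes "orthonormal_basis K v"
  shows "padded_basis (\<lambda>k. if k \<in> K then v k else 0)"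
proof
  have v: "\<And>j k. j \<in> K \<Longrightarrow> k \<in> K \<Longrightarrow> v j \<bullet> v k = (if j = k then 1 else 0)"
    and tot: "closure (span (v ` K)) = UNIV"
    using assms unfolding orthonormal_basis_def by auto
  show "j \<noteq> k \<Longrightarrow> (if j \<in> K then v j else 0) \<bullet> (if k \<in> K then v k else 0) = 0" for j k
    using v by simp
  show "(if k \<in> K then v k else 0) \<noteq> 0 \<Longrightarrow>
      (if k \<in> K then v k else 0) \<bullet> (if k \<in> K then v k else 0) = 1" for k
    using v by (auto split: if_splits)
  define R where "R = range (\<lambda>k. if k \<in> K then v k else 0)"
  have "v ` K \<subseteq> R"
    unfolding R_def by force
  then have "closure (span (v ` K)) \<subseteq> closure (span R)"
    by (rule closure_mono[OF span_mono])
  then have "closure (span R) = UNIV"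
    unfolding tot by (simp only: top.extremum_unique)
  then show "closure (span (range (\<lambda>k. if k \<in> K then v k else 0))) = UNIV"
    unfolding R_def .
qed

text \<open>By Pythagoras the squared norm of a block of the series is the corresponding block of
  the series of squares, so the Cauchy criterion carries over.\<close>

lemma orthogonal_series_summable:
  fixes w :: "nat \<Rightarrow> 'a::{real_inner, banach}"
  assumes orth: "\<And>j k. j \<noteq> k \<Longrightarrow> w j \<bullet> w k = 0" and sq: "summable (\<lambda>k. (norm (w k))\<^sup>2)"
  shows "summable w"
  unfolding summable_Cauchy
proof (intro allI impI)
  fix r :: real assume "0 < r"
  then obtain N where N: "\<And>m n. m \<ge> N \<Longrightarrow> norm (\<Sum>k=m..<n. (norm (w k))\<^sup>2) < r\<^sup>2"
    using sq unfolding summable_Cauchy by (meson zero_less_power)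
  have "norm (sum w {m..<n}) < r" if "m \<ge> N" for m n
  proof -
    have "(norm (sum w {m..<n}))\<^sup>2 = (\<Sum>k=m..<n. (norm (w k))\<^sup>2)"
      by (intro norm_sum_Pythagorean) (auto simp: pairwise_def orthogonal_def orth)
    also have "\<dots> < r\<^sup>2"
      using N[OF that, of n] by simp
    finally show ?thesis
      by (rule power_less_imp_less_base) (use \<open>0 < r\<close> in simp)
  qed
  then show "\<exists>N. \<forall>m\<ge>N. \<forall>n. norm (sum w {m..<n}) < r"
    by blast
qed

subsection \<open>Gaussian measures\<close>

lemma normal_law_1: "normal_law 1 = std_normal_distribution"
  by (simp add: normal_law_def)

lemma sets_normal_law [simp, measurable_cong]: "sets (normal_law s) = sets borel"
  by (simp add: normal_law_def)

lemma space_normal_law [simp]: "space (normal_law s) = UNIV"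
  by (simp add: normal_law_def)

text \<open>Scaling a standard normal variable also produces the point mass at \<open>s = 0\<close>,
  so characteristic functions and moments can be computed without a case distinction.\<close>

lemma normal_law_eq_distr:
  assumes "0 \<le> s"
  shows "normal_law s = distr (normal_law 1) borel (\<lambda>x. sqrt s * x)"
proof (cases "s = 0")
  case True
  interpret prob_space "normal_law 1"
    unfolding normal_law_1 by (rule prob_space_normal_density) simp
  show ?thesis
    using True by (simp add: normal_law_def[of 0] distr_const)
next
  case False
  then have s: "0 < s" using assms by simp
  let ?M = "std_normal_distribution"
  interpret prob_space ?M by (rule prob_space_normal_density) simp
  have "distributed ?M lborel (\<lambda>x. x) (normal_density 0 1)"
    unfolding distributed_def by (auto simp: distr_id2)
  from normal_density_affine[OF this, of "sqrt s" 0]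
  have "distributed ?M lborel (\<lambda>x. 0 + sqrt s * x) (normal_density 0 (sqrt s))"
    using s by simp
  then have "distr ?M lborel (\<lambda>x. sqrt s * x) = density lborel (normal_density 0 (sqrt s))"
    by (simp add: distributed_def)
  then show ?thesis
    using s by (simp add: normal_law_def[of s] normal_law_1 cong: distr_cong)
qed

lemma prob_space_normal_law: "0 \<le> s \<Longrightarrow> prob_space (normal_law s)"
  using real_dist_normal_dist
  by (subst normal_law_eq_distr)
    (auto simp: normal_law_1 real_distribution_def intro!: prob_space.prob_space_distr)

lemma char_normal_law:
  assumes "0 \<le> s"
  shows "char (normal_law s) t = exp (- (s * t\<^sup>2) / 2)"
proof -
  have "char (normal_law s) t = char (normal_law 1) (sqrt s * t)"
    by (subst normal_law_eq_distr[OF assms]) (simp add: char_def integral_distr ac_simps)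
  then show ?thesis
    using assms by (simp add: normal_law_1 char_std_normal_distribution power_mult_distrib)
qed

lemma second_moment_normal_law:
  assumes "0 \<le> s"
  shows "integrable (normal_law s) (\<lambda>x. x\<^sup>2)" "(\<integral>x. x\<^sup>2 \<partial>normal_law s) = s"
proof -
  have 1: "integrable (normal_law 1) (\<lambda>x. x\<^sup>2)" "(\<integral>x. x\<^sup>2 \<partial>normal_law 1) = 1"
    unfolding normal_law_1
    using std_normal_distribution_even_moments[of 1] by (simp_all add: fact_numeral)
  show "integrable (normal_law s) (\<lambda>x. x\<^sup>2)"
    using 1 by (subst normal_law_eq_distr[OF assms])
      (simp add: integrable_distr_eq power_mult_distrib)
  show "(\<integral>x. x\<^sup>2 \<partial>normal_law s) = s"
    using 1 assms by (subst normal_law_eq_distr[OF assms])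
      (simp add: integral_distr power_mult_distrib)
qed

text \<open>Independence means that the joint law is the product of the component laws; here the
  joint law is the product measure itself.\<close>

lemma indep_vars_PiM_coordinates:
  assumes "\<And>i. i \<in> I \<Longrightarrow> prob_space (M i)" "I \<noteq> {}"
  shows "prob_space.indep_vars (PiM I M) M (\<lambda>i \<omega>. \<omega> i) I"
proof -
  interpret prob_space "PiM I M"
    by (intro prob_space_PiM assms)
  have "distr (PiM I M) (PiM I M) (\<lambda>x. \<lambda>i\<in>I. x i) = distr (PiM I M) (PiM I M) (\<lambda>x. x)"
    by (intro distr_cong) (auto simp: space_PiM PiE_restrict)
  also have "\<dots> = PiM I M"
    by (simp add: distr_id2)
  also have "\<dots> = PiM I (\<lambda>i. distr (PiM I M) (M i) (\<lambda>\<omega>. \<omega> i))"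
    using assms by (intro PiM_cong) (auto simp: distr_PiM_component)
  finally show ?thesis
    by (subst indep_vars_iff_distr_eq_PiM') (use assms in auto)
qed

theorem gaussian_series_law:
  fixes w :: "nat \<Rightarrow> 'a::{real_inner, banach, second_countable_topology}"
  assumes orth: "\<And>j k. j \<noteq> k \<Longrightarrow> w j \<bullet> w k = 0" and sq: "summable (\<lambda>k. (norm (w k))\<^sup>2)"
  shows "\<exists>\<pi>. prob_space \<pi> \<and> sets \<pi> = sets borel \<and>
    (\<forall>h. distr \<pi> borel (\<lambda>x. h \<bullet> x) = normal_law (\<Sum>k. (h \<bullet> w k)\<^sup>2))"
proof -
  define P where "P = PiM (UNIV :: nat set) (\<lambda>_. normal_law 1)"
  have n1: "prob_space (normal_law 1)" by (rule prob_space_normal_law) simp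
  interpret P: prob_space P
    unfolding P_def by (intro prob_space_PiM n1)
  have coord [measurable]: "(\<lambda>\<omega>. \<omega> k) \<in> borel_measurable P" for k :: nat
    unfolding P_def by measurable
  have law: "distr P borel (\<lambda>\<omega>. \<omega> k) = normal_law 1" for k :: nat
  proof -
    have "distr P borel (\<lambda>\<omega>. \<omega> k) = distr P (normal_law 1) (\<lambda>\<omega>. \<omega> k)"
      by (intro distr_cong) auto
    also have "\<dots> = normal_law 1"
      unfolding P_def by (intro distr_PiM_component n1) simp
    finally show ?thesis .
  qed
  \<comment> \<open>The expected sum of squared norms equals the finite sum of the
    \<open>(norm (w k))\<^sup>2\<close>, so it is finite almost surely; orthogonality turns this
    into convergence of the random series.\<close>
  have "(\<integral>\<^sup>+\<omega>. (\<Sum>k. ennreal ((norm (\<omega> k *\<^sub>R w k))\<^sup>2)) \<partial>P) =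
      (\<Sum>k. \<integral>\<^sup>+\<omega>. ennreal ((norm (\<omega> k *\<^sub>R w k))\<^sup>2) \<partial>P)"
    by (intro nn_integral_suminf) measurable
  also have "\<dots> = (\<Sum>k. ennreal ((norm (w k))\<^sup>2))"
  proof (intro suminf_cong)
    fix k
    have "integrable (distr P borel (\<lambda>\<omega>. \<omega> k)) (\<lambda>x. x\<^sup>2)"
      "(\<integral>x. x\<^sup>2 \<partial>distr P borel (\<lambda>\<omega>. \<omega> k)) = 1"
      unfolding law using second_moment_normal_law[of 1] by simp_all
    then have "integrable P (\<lambda>\<omega>. (\<omega> k)\<^sup>2)" "(\<integral>\<omega>. (\<omega> k)\<^sup>2 \<partial>P) = 1"
      by (simp_all add: integrable_distr_eq integral_distr)
    then show "(\<integral>\<^sup>+\<omega>. ennreal ((norm (\<omega> k *\<^sub>R w k))\<^sup>2) \<partial>P) = ennreal ((norm (w k))\<^sup>2)"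
      by (subst nn_integral_eq_integral) (simp_all add: power_mult_distrib)
  qed
  also have "\<dots> \<noteq> \<infinity>"
    using sq by (simp add: suminf_ennreal2)
  finally have "AE \<omega> in P. (\<Sum>k. ennreal ((norm (\<omega> k *\<^sub>R w k))\<^sup>2)) \<noteq> \<infinity>"
    by (intro nn_integral_noteq_infinite) measurable
  then have conv: "AE \<omega> in P. summable (\<lambda>k. \<omega> k *\<^sub>R w k)"
  proof eventually_elim
    case (elim \<omega>)
    then have "summable (\<lambda>k. (norm (\<omega> k *\<^sub>R w k))\<^sup>2)"
      by (intro summable_suminf_not_top) (simp_all only: infinity_ennreal_def not_False_eq_True zero_le_power2)
    then show ?case
      by (rule orthogonal_series_summable[rotated]) (simp add: orth)
  qed
  \<comment> \<open>On the null set where the series diverges, \<open>suminf\<close> is some fixed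
    value, which does not affect the law.\<close>
  define S where "S \<omega> = (\<Sum>k. \<omega> k *\<^sub>R w k)" for \<omega> :: "nat \<Rightarrow> real"
  have S [measurable]: "S \<in> borel_measurable P"
    unfolding S_def by measurable
  \<comment> \<open>Independence gives the characteristic function of each partial sum of
    \<open>h \<bullet> S \<omega>\<close>; dominated convergence with bound 1 passes to the
    limit.\<close>
  have "distr (distr P borel S) borel (\<lambda>x. h \<bullet> x) = normal_law (\<Sum>k. (h \<bullet> w k)\<^sup>2)" for h
  proof (rule Levy_uniqueness)
    let ?s = "\<Sum>k. (h \<bullet> w k)\<^sup>2"
    have sum_s: "summable (\<lambda>k. (h \<bullet> w k)\<^sup>2)"
    proof (rule summable_comparison_test'[where N = 0])
      show "summable (\<lambda>k. (norm h)\<^sup>2 * (norm (w k))\<^sup>2)"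
        by (intro summable_mult sq)
      fix k
      have "\<bar>h \<bullet> w k\<bar>\<^sup>2 \<le> (norm h * norm (w k))\<^sup>2"
        by (intro power_mono Cauchy_Schwarz_ineq2) simp
      then show "norm ((h \<bullet> w k)\<^sup>2) \<le> (norm h)\<^sup>2 * (norm (w k))\<^sup>2"
        by (simp add: power_mult_distrib)
    qed
    then have s0: "0 \<le> ?s" by (intro suminf_nonneg) auto
    interpret D: prob_space "distr P borel S"
      by (intro P.prob_space_distr) measurable
    have hmeas [measurable]: "(\<lambda>x. h \<bullet> x) \<in> borel_measurable (borel :: 'a measure)"
      by (rule measurable_inner_const) simp
    show "real_distribution (distr (distr P borel S) borel (\<lambda>x. h \<bullet> x))"
      by (intro D.real_distribution_distr) measurable
    show "real_distribution (normal_law ?s)"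
      using prob_space_normal_law[OF s0] by (simp add: real_distribution_def real_distribution_axioms_def)
    show "char (distr (distr P borel S) borel (\<lambda>x. h \<bullet> x)) = char (normal_law ?s)"
    proof
      fix t
      have indep: "P.indep_vars (\<lambda>_. borel) (\<lambda>k \<omega>. \<omega> k * (h \<bullet> w k)) {..<n}" for n
      proof -
        have "P.indep_vars (\<lambda>_. normal_law 1) (\<lambda>k \<omega>. \<omega> k) UNIV"
          unfolding P_def by (intro indep_vars_PiM_coordinates n1) simp
        moreover have "(\<lambda>x. x * r) \<in> borel_measurable (normal_law 1)" for r
          by (intro borel_measurable_times borel_measurable_const measurable_ident_sets) simp
        ultimately have "P.indep_vars (\<lambda>_. borel) (\<lambda>k \<omega>. \<omega> k * (h \<bullet> w k)) UNIV"
          by (rule P.indep_vars_compose2[where Y = "\<lambda>k x. x * (h \<bullet> w k)"])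
        then show ?thesis
          by (rule P.indep_vars_subset) simp
      qed
      have "char (distr P borel (\<lambda>\<omega>. \<omega> k * (h \<bullet> w k))) t = exp (- ((h \<bullet> w k)\<^sup>2 * t\<^sup>2 / 2))" for k
      proof -
        have "char (distr P borel (\<lambda>\<omega>. \<omega> k * (h \<bullet> w k))) t = char (distr P borel (\<lambda>\<omega>. \<omega> k)) (t * (h \<bullet> w k))"
          by (simp add: char_def integral_distr ac_simps)
        also have "\<dots> = exp (- ((h \<bullet> w k)\<^sup>2 * t\<^sup>2 / 2))"
          by (simp add: law char_normal_law power_mult_distrib ac_simps)
        finally show ?thesis .
      qed
      then have "char (distr P borel (\<lambda>\<omega>. \<Sum>k<n. \<omega> k * (h \<bullet> w k))) t =
          complex_of_real (\<Prod>k<n. exp (- ((h \<bullet> w k)\<^sup>2 * t\<^sup>2 / 2)))" for n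
        using P.char_distr_sum[OF indep[of n], of t] by simp
      then have partial: "(\<integral>\<omega>. iexp (t * (\<Sum>k<n. \<omega> k * (h \<bullet> w k))) \<partial>P) =
          complex_of_real (exp (- ((\<Sum>k<n. (h \<bullet> w k)\<^sup>2) * t\<^sup>2 / 2)))" for n
        by (simp add: char_def integral_distr exp_sum[symmetric] sum_negf sum_divide_distrib
            sum_distrib_right del: of_real_prod)
      have "(\<lambda>n. \<integral>\<omega>. iexp (t * (\<Sum>k<n. \<omega> k * (h \<bullet> w k))) \<partial>P) \<longlonglongrightarrow> (\<integral>\<omega>. iexp (t * (h \<bullet> S \<omega>)) \<partial>P)"
      proof (rule integral_dominated_convergence[where w = "\<lambda>_. 1"])
        show "AE \<omega> in P. (\<lambda>n. iexp (t * (\<Sum>k<n. \<omega> k * (h \<bullet> w k)))) \<longlonglongrightarrow> iexp (t * (h \<bullet> S \<omega>))"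
          using conv
        proof eventually_elim
          case (elim \<omega>)
          then have "(\<lambda>k. \<omega> k *\<^sub>R w k) sums S \<omega>"
            unfolding S_def by (rule summable_sums)
          then have "(\<lambda>k. h \<bullet> (\<omega> k *\<^sub>R w k)) sums (h \<bullet> S \<omega>)"
            by (rule bounded_linear.sums[OF bounded_linear_inner_right])
          then have "(\<lambda>n. \<Sum>k<n. \<omega> k * (h \<bullet> w k)) \<longlonglongrightarrow> h \<bullet> S \<omega>"
            by (simp add: sums_def)
          then show ?case
            by (intro tendsto_intros)
        qed
        show "(\<lambda>\<omega>. iexp (t * (h \<bullet> S \<omega>))) \<in> borel_measurable P"
          by measurable
      qed (auto simp: norm_exp_i_times)
      moreover have "(\<lambda>n. complex_of_real (exp (- ((\<Sum>k<n. (h \<bullet> w k)\<^sup>2) * t\<^sup>2 / 2)))) \<longlonglongrightarrow>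
          complex_of_real (exp (- (?s * t\<^sup>2 / 2)))"
        using summable_LIMSEQ[OF sum_s] by (intro tendsto_intros) auto
      ultimately have "(\<integral>\<omega>. iexp (t * (h \<bullet> S \<omega>)) \<partial>P) = exp (- (?s * t\<^sup>2 / 2))"
        unfolding partial by (rule LIMSEQ_unique)
      then show "char (distr (distr P borel S) borel (\<lambda>x. h \<bullet> x)) t = char (normal_law ?s) t"
        unfolding char_normal_law[OF s0] by (simp add: char_def integral_distr)
    qed
  qed
  moreover have "prob_space (distr P borel S)"
    by (intro P.prob_space_distr) measurable
  ultimately show ?thesis
    by (intro exI[of _ "distr P borel S"]) auto
qed

subsection \<open>Diagonal operators\<close>

locale hilbert_padded_basis = padded_basis e for e :: "nat \<Rightarrow> 'a::{real_inner, banach}"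
begin

definition diag :: "(nat \<Rightarrow> real) \<Rightarrow> 'a \<Rightarrow> 'a" where
  "diag c x = (\<Sum>k. (c k * (e k \<bullet> x)) *\<^sub>R e k)"

text \<open>Bounded rather than summable coefficients are assumed because square roots of summable
  eigenvalues need not be summable. Convergence comes from orthogonality, not from absolute
  convergence.\<close>

lemma sums_diag:
  assumes c: "\<And>k. \<bar>c k\<bar> \<le> C"
  shows "(\<lambda>k. (c k * (e k \<bullet> x)) *\<^sub>R e k) sums diag c x"
  unfolding diag_def
proof (rule summable_sums, rule orthogonal_series_summable)
  show "((c j * (e j \<bullet> x)) *\<^sub>R e j) \<bullet> ((c k * (e k \<bullet> x)) *\<^sub>R e k) = 0" if "j \<noteq> k" for j k
    using orth[OF that] by simp
  have "summable (\<lambda>k. C\<^sup>2 * (e k \<bullet> x)\<^sup>2)"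
    using parseval_norm[of x] by (intro summable_mult) (auto simp: sums_iff)
  then show "summable (\<lambda>k. (norm ((c k * (e k \<bullet> x)) *\<^sub>R e k))\<^sup>2)"
  proof (rule summable_comparison_test'[where N = 0])
    fix k
    have "(norm (e k))\<^sup>2 \<le> 1"
      using inner_basis[of k k] by (simp add: power2_norm_eq_inner)
    then have "(c k)\<^sup>2 * (norm (e k))\<^sup>2 \<le> C\<^sup>2 * 1"
      using c[of k] by (intro mult_mono) (auto simp: abs_le_square_iff[symmetric])
    then have "((c k)\<^sup>2 * (norm (e k))\<^sup>2) * (e k \<bullet> x)\<^sup>2 \<le> C\<^sup>2 * (e k \<bullet> x)\<^sup>2"
      by (intro mult_right_mono) auto
    then show "norm ((norm ((c k * (e k \<bullet> x)) *\<^sub>R e k))\<^sup>2) \<le> C\<^sup>2 * (e k \<bullet> x)\<^sup>2"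
      by (simp add: power_mult_distrib ac_simps)
  qed
qed

lemma inner_diag:
  assumes "\<And>k. \<bar>c k\<bar> \<le> C"
  shows "e j \<bullet> diag c x = c j * (e j \<bullet> x)"
proof -
  have "(\<lambda>k. e j \<bullet> ((c k * (e k \<bullet> x)) *\<^sub>R e k)) sums (e j \<bullet> diag c x)"
    by (rule bounded_linear.sums[OF bounded_linear_inner_right sums_diag[OF assms]])
  moreover have "(\<lambda>k. e j \<bullet> ((c k * (e k \<bullet> x)) *\<^sub>R e k)) = (\<lambda>k. if k = j then c j * (e j \<bullet> x) else 0)"
    by (auto simp: inner_basis fun_eq_iff)
  ultimately show ?thesis
    using sums_single[of j "\<lambda>k. c j * (e j \<bullet> x)"] sums_unique2 by simp
qed

lemma positive_operator_diag:
  assumes c: "\<And>k. 0 \<le> c k" "\<And>k. c k \<le> C"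
  shows "positive_operator (diag c)"
proof -
  have c': "\<And>k. \<bar>c k\<bar> \<le> C"
    using c by simp
  note diag = inner_diag[OF c']
  have "bounded_linear (diag c)"
  proof (rule bounded_linear_intro)
    show "diag c (x + y) = diag c x + diag c y" for x y
      by (rule eq_if_inner_basis_eq) (simp add: diag inner_add_right distrib_left)
    show "diag c (r *\<^sub>R x) = r *\<^sub>R diag c x" for r x
      by (rule eq_if_inner_basis_eq) (simp add: diag)
    show "norm (diag c x) \<le> norm x * C" for x
    proof -
      have "(norm (diag c x))\<^sup>2 \<le> C\<^sup>2 * (norm x)\<^sup>2"
      proof (rule sums_le)
        show "(\<lambda>k. (e k \<bullet> diag c x)\<^sup>2) sums (norm (diag c x))\<^sup>2"
          by (rule parseval_norm)
        show "(\<lambda>k. C\<^sup>2 * (e k \<bullet> x)\<^sup>2) sums (C\<^sup>2 * (norm x)\<^sup>2)"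
          by (intro sums_mult parseval_norm)
        show "(e k \<bullet> diag c x)\<^sup>2 \<le> C\<^sup>2 * (e k \<bullet> x)\<^sup>2" for k
          using c by (simp add: diag power_mult_distrib mult_right_mono power_mono)
      qed
      then have "(norm (diag c x))\<^sup>2 \<le> (norm x * C)\<^sup>2"
        by (simp add: power_mult_distrib mult.commute)
      moreover have "0 \<le> C"
        using c[of 0] by linarith
      ultimately have "0 \<le> norm x * C"
        by simp
      with \<open>(norm (diag c x))\<^sup>2 \<le> (norm x * C)\<^sup>2\<close> show ?thesis
        by (rule power2_le_imp_le)
    qed
  qed
  moreover have "diag c x \<bullet> y = x \<bullet> diag c y" for x y
  proof (rule sums_unique2)
    show "(\<lambda>k. (e k \<bullet> diag c x) * (e k \<bullet> y)) sums (diag c x \<bullet> y)"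
      by (rule parseval)
    show "(\<lambda>k. (e k \<bullet> diag c x) * (e k \<bullet> y)) sums (x \<bullet> diag c y)"
      using parseval[of x "diag c y"] by (simp add: diag ac_simps)
  qed
  moreover have "0 \<le> x \<bullet> diag c x" for x
  proof (rule sums_le)
    show "(\<lambda>k. (e k \<bullet> x) * (e k \<bullet> diag c x)) sums (x \<bullet> diag c x)"
      by (rule parseval)
    show "(\<lambda>k. 0) sums (0 :: real)"
      by simp
    show "0 \<le> (e k \<bullet> x) * (e k \<bullet> diag c x)" for k
      using c(1)[of k] mult_nonneg_nonneg[OF c(1)[of k] zero_le_square[of "e k \<bullet> x"]]
      by (simp add: diag ac_simps)
  qed
  ultimately show ?thesis
    unfolding positive_operator_def by blast
qed

text \<open>As \<open>operator_sqrt\<close> is a definite description, uniqueness has to be proved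
  too. Every positive square root acts on \<open>e k\<close> as multiplication by
  \<open>sqrt (c k)\<close>, and by symmetry this fixes all its coordinates.\<close>

lemma operator_sqrt_diag:
  assumes c: "\<And>k. 0 \<le> c k" "\<And>k. c k \<le> C"
  shows "operator_sqrt (diag c) = diag (\<lambda>k. sqrt (c k))"
proof -
  have c': "\<And>k. \<bar>c k\<bar> \<le> C" and s: "\<And>k. \<bar>sqrt (c k)\<bar> \<le> sqrt C"
    using c by auto
  note diag = inner_diag[OF c'] and diag_sqrt = inner_diag[OF s]
  show ?thesis
    unfolding operator_sqrt_def
  proof (rule the_equality)
    have "positive_operator (diag (\<lambda>k. sqrt (c k)))"
      by (rule positive_operator_diag[where C = "sqrt C"]) (use c in auto)
    moreover have "diag (\<lambda>k. sqrt (c k)) (diag (\<lambda>k. sqrt (c k)) x) = diag c x" for x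
      by (rule eq_if_inner_basis_eq)
        (simp add: diag diag_sqrt mult.assoc[symmetric] real_sqrt_mult_self c abs_of_nonneg)
    ultimately show "positive_operator (diag (\<lambda>k. sqrt (c k))) \<and>
        diag (\<lambda>k. sqrt (c k)) \<circ> diag (\<lambda>k. sqrt (c k)) = diag c"
      by auto
  next
    fix B assume "positive_operator B \<and> B \<circ> B = diag c"
    then have lin: "bounded_linear B" and sym: "\<And>x y. B x \<bullet> y = x \<bullet> B y"
      and pos: "\<And>x. 0 \<le> x \<bullet> B x" and BB: "\<And>x. B (B x) = diag c x"
      unfolding positive_operator_def by (auto simp: fun_eq_iff)
    interpret B: bounded_linear B by (rule lin)
    have Be: "B (e k) = sqrt (c k) *\<^sub>R e k" for k
    proof (cases "c k = 0")
      case True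
      \<comment> \<open>By symmetry this is the inner product of \<open>e k\<close> with
        \<open>B (B (e k))\<close>, which is \<open>diag c (e k)\<close>.\<close>
      have "B (e k) \<bullet> B (e k) = 0"
        using sym[of "e k" "B (e k)"] True by (simp add: BB diag)
      then show ?thesis using True by simp
    next
      case False
      define u where "u = B (e k) - sqrt (c k) *\<^sub>R e k"
      have "diag c (e k) = c k *\<^sub>R e k"
        by (rule eq_if_inner_basis_eq) (simp add: diag inner_basis)
      \<comment> \<open>\<open>(B + s)(B - s) e = 0\<close> makes \<open>u\<close> an eigenvector of \<open>B\<close> for the negative value \<open>- s\<close>.\<close>
      then have "B u = - (sqrt (c k) *\<^sub>R u)"
        by (simp add: u_def B.diff B.scaleR BB scaleR_diff_right real_sqrt_mult_self c abs_of_nonneg)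
      with pos[of u] have "sqrt (c k) * (u \<bullet> u) \<le> 0"
        by simp
      moreover have "0 < sqrt (c k)"
        using False c(1)[of k] by simp
      ultimately have "u \<bullet> u \<le> 0"
        by (simp add: mult_le_0_iff)
      then have "u = 0"
        using inner_gt_zero_iff[of u] by linarith
      then show ?thesis
        by (simp add: u_def)
    qed
    show "B = diag (\<lambda>k. sqrt (c k))"
    proof
      fix x
      show "B x = diag (\<lambda>k. sqrt (c k)) x"
        by (rule eq_if_inner_basis_eq) (simp add: diag_sqrt Be sym[symmetric])
    qed
  qed
qed

end

section \<open>Trace-class series; existence, uniqueness and moments of Gaussian measures\<close>

lemma covariance_operator_series:
  fixes w :: "nat \<Rightarrow> 'a::{real_inner, banach}"
  assumes sq: "summable (\<lambda>k. (norm (w k))\<^sup>2)"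
  shows "covariance_operator (\<lambda>x. \<Sum>k. (w k \<bullet> x) *\<^sub>R w k)"
    and "(\<lambda>k. (w k \<bullet> x) *\<^sub>R w k) sums (\<Sum>k. (w k \<bullet> x) *\<^sub>R w k)"
    and "(\<lambda>k. (w k \<bullet> x) * (w k \<bullet> y)) sums (x \<bullet> (\<Sum>k. (w k \<bullet> y) *\<^sub>R w k))"
proof -
  define A where "A x = (\<Sum>k. (w k \<bullet> x) *\<^sub>R w k)" for x
  have bd: "norm ((w k \<bullet> x) *\<^sub>R w k) \<le> (norm (w k))\<^sup>2 * norm x" for k x
    using mult_right_mono[OF Cauchy_Schwarz_ineq2[of "w k" x] norm_ge_zero[of "w k"]]
    by (simp add: power2_eq_square ac_simps)
  have sn: "summable (\<lambda>k. norm ((w k \<bullet> x) *\<^sub>R w k))" for x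
    by (rule summable_comparison_test'[where N = 0, OF summable_mult2[OF sq, of "norm x"]])
      (use bd in simp)
  have A: "(\<lambda>k. (w k \<bullet> x) *\<^sub>R w k) sums A x" for x
    unfolding A_def using sn by (intro summable_sums) (rule summable_norm_cancel)
  have inner: "(\<lambda>k. (w k \<bullet> x) * (w k \<bullet> y)) sums (x \<bullet> A y)" for x y
    using bounded_linear.sums[OF bounded_linear_inner_right A, of x y]
    by (simp add: ac_simps inner_commute)
  have "bounded_linear A"
  proof (rule bounded_linear_intro)
    show "A (x + y) = A x + A y" for x y
      using sums_add[OF A[of x] A[of y]]
      by (intro sums_unique2[OF A]) (simp add: inner_add_right scaleR_add_left)
    show "A (r *\<^sub>R x) = r *\<^sub>R A x" for r x
      using bounded_linear.sums[OF bounded_linear_scaleR_right A, of r x]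
      by (intro sums_unique2[OF A]) simp
    show "norm (A x) \<le> norm x * (\<Sum>k. (norm (w k))\<^sup>2)" for x
    proof -
      have "norm (A x) \<le> (\<Sum>k. norm ((w k \<bullet> x) *\<^sub>R w k))"
        unfolding A_def by (rule summable_norm[OF sn])
      also have "\<dots> \<le> (\<Sum>k. (norm (w k))\<^sup>2 * norm x)"
        by (intro suminf_le bd sn summable_mult2 sq)
      also have "\<dots> = norm x * (\<Sum>k. (norm (w k))\<^sup>2)"
        using suminf_mult2[OF sq, of "norm x"] by (simp add: mult.commute)
      finally show ?thesis .
    qed
  qed
  moreover have "A x \<bullet> y = x \<bullet> A y" for x y
    using inner[of x y] inner[of y x]
    by (simp add: mult.commute sums_iff inner_commute[of "A x"])
  moreover have "0 \<le> x \<bullet> A x" for x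
    using sums_le[OF _ sums_zero inner[of x x]] by simp
  ultimately have "positive_operator A"
    unfolding positive_operator_def by blast
  moreover have "(\<lambda>k. v k \<bullet> A (v k)) summable_on K" if "orthonormal_basis K v" for K v
  proof (rule nonneg_bdd_above_summable_on)
    interpret padded_basis "\<lambda>k. if k \<in> K then v k else 0"
      by (rule padded_basis_if_orthonormal_basis[OF that])
    show "0 \<le> v k \<bullet> A (v k)" for k
      using \<open>positive_operator A\<close> unfolding positive_operator_def by blast
    \<comment> \<open>Expanding \<open>A\<close> turns a partial trace into a series over
      \<open>j\<close>; Bessel for each \<open>w j\<close> bounds it independently of
      \<open>F\<close> and of the basis.\<close>
    have "(\<Sum>k\<in>F. v k \<bullet> A (v k)) \<le> (\<Sum>j. (norm (w j))\<^sup>2)" if F: "F \<subseteq> K" "finite F" for F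
    proof -
      have "(\<lambda>j. \<Sum>k\<in>F. (w j \<bullet> v k) * (w j \<bullet> v k)) sums (\<Sum>k\<in>F. v k \<bullet> A (v k))"
        by (intro sums_sum inner)
      from this show ?thesis
      proof (rule sums_le[rotated])
        show "(\<lambda>k. (norm (w k))\<^sup>2) sums (\<Sum>j. (norm (w j))\<^sup>2)"
          using sq by (rule summable_sums)
        show "(\<Sum>k\<in>F. (w j \<bullet> v k) * (w j \<bullet> v k)) \<le> (norm (w j))\<^sup>2" for j
        proof -
          have "(\<Sum>k\<in>F. (w j \<bullet> v k) * (w j \<bullet> v k)) = (\<Sum>k\<in>F. ((if k \<in> K then v k else 0) \<bullet> w j)\<^sup>2)"
            using F by (intro sum.cong) (auto simp: power2_eq_square inner_commute)
          then show ?thesis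
            using bessel[OF F(2), of "w j"] by simp
        qed
      qed
    qed
    then show "bdd_above (sum (\<lambda>k. v k \<bullet> A (v k)) ` {F. F \<subseteq> K \<and> finite F})"
      by (intro bdd_aboveI2) auto
  qed
  ultimately show "covariance_operator (\<lambda>x. \<Sum>k. (w k \<bullet> x) *\<^sub>R w k)"
    unfolding covariance_operator_def A_def by blast
  show "(\<lambda>k. (w k \<bullet> x) *\<^sub>R w k) sums (\<Sum>k. (w k \<bullet> x) *\<^sub>R w k)"
    and "(\<lambda>k. (w k \<bullet> x) * (w k \<bullet> y)) sums (x \<bullet> (\<Sum>k. (w k \<bullet> y) *\<^sub>R w k))"
    using A inner unfolding A_def by auto
qed

theorem exists_gaussian_series:
  fixes w :: "nat \<Rightarrow> 'a::{real_inner, banach, second_countable_topology}"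
  assumes orth: "\<And>j k. j \<noteq> k \<Longrightarrow> w j \<bullet> w k = 0" and sq: "summable (\<lambda>k. (norm (w k))\<^sup>2)"
  shows "\<exists>\<pi>. is_gaussian (\<lambda>x. \<Sum>k. (w k \<bullet> x) *\<^sub>R w k) \<pi>"
proof -
  have "(\<Sum>k. (h \<bullet> w k)\<^sup>2) = h \<bullet> (\<Sum>k. (w k \<bullet> h) *\<^sub>R w k)" for h
    using covariance_operator_series(3)[OF sq, of h h]
    by (simp add: sums_iff power2_eq_square inner_commute)
  then show ?thesis
    using gaussian_series_law[OF orth sq] covariance_operator_series(1)[OF sq]
    unfolding is_gaussian_def by simp
qed

lemma is_gaussian_unique:
  fixes \<mu> \<nu> :: "'a::{real_inner, second_countable_topology} measure"
  assumes "is_gaussian A \<mu>" "is_gaussian A \<nu>"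
  shows "\<mu> = \<nu>"
  using assms unfolding is_gaussian_def by (intro measure_eqI_projections[of \<mu> \<nu>]) metis+

lemma gaussian_second_moment:
  assumes "is_gaussian A \<mu>"
  shows "integrable \<mu> (\<lambda>x. (h \<bullet> x) * (g \<bullet> x))"
    and "(\<integral>x. (h \<bullet> x) * (g \<bullet> x) \<partial>\<mu>) = h \<bullet> A g"
proof -
  have sets: "sets \<mu> = sets borel" and law: "\<And>h. distr \<mu> borel (\<lambda>x. h \<bullet> x) = normal_law (h \<bullet> A h)"
    and pos: "\<And>h. 0 \<le> h \<bullet> A h" and sym: "A h \<bullet> g = h \<bullet> A g" and lin: "bounded_linear A"
    using assms unfolding is_gaussian_def covariance_operator_def positive_operator_def by auto
  interpret A: bounded_linear A by (rule lin)
  note [measurable] = measurable_inner_const[OF sets]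
  have sq: "integrable \<mu> (\<lambda>x. (h \<bullet> x)\<^sup>2)" "(\<integral>x. (h \<bullet> x)\<^sup>2 \<partial>\<mu>) = h \<bullet> A h" for h
    using second_moment_normal_law[OF pos[of h]] unfolding law[symmetric]
    by (simp_all add: integrable_distr_eq integral_distr)
  \<comment> \<open>Polarisation: the definition gives the law of each single functional, hence
    squares, and mixed moments follow from these.\<close>
  have polar: "(h \<bullet> x) * (g \<bullet> x) = (((h + g) \<bullet> x)\<^sup>2 - (h \<bullet> x)\<^sup>2 - (g \<bullet> x)\<^sup>2) / 2" for x
    by (simp add: inner_add_left power2_eq_square algebra_simps)
  show "integrable \<mu> (\<lambda>x. (h \<bullet> x) * (g \<bullet> x))"
    unfolding polar using sq(1) by (intro integrable_diff integrable_divide_zero) auto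
  have "(\<integral>x. (h \<bullet> x) * (g \<bullet> x) \<partial>\<mu>) = ((h + g) \<bullet> A (h + g) - h \<bullet> A h - g \<bullet> A g) / 2"
    unfolding polar by (simp add: sq)
  also have "\<dots> = h \<bullet> A g"
    using sym by (simp add: A.add inner_add_left inner_add_right inner_commute[of g "A h"])
  finally show "(\<integral>x. (h \<bullet> x) * (g \<bullet> x) \<partial>\<mu>) = h \<bullet> A g" .
qed

subsection \<open>The rearrangement inequality for substochastic matrices\<close>

text \<open>A nonnegative non-increasing weight is a nonnegative combination of indicators of
  initial segments, so comparing partial sums is enough.\<close>

lemma weighted_sum_mono_antimono:
  fixes a u z :: "nat \<Rightarrow> real"
  assumes a: "\<And>k. 0 \<le> a k" "\<And>k. a (Suc k) \<le> a k"
    and le: "\<And>n. n \<le> N \<Longrightarrow> (\<Sum>k<n. u k) \<le> (\<Sum>k<n. z k)"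
  shows "(\<Sum>k<N. a k * u k) \<le> (\<Sum>k<N. a k * z k)"
proof -
  \<comment> \<open>summation by parts\<close>
  have "a n * (\<Sum>k<n. z k - u k) \<le> (\<Sum>k<n. a k * (z k - u k))" if "n \<le> N" for n
    using that
  proof (induction n)
    case (Suc n)
    have "a (Suc n) * (\<Sum>k<Suc n. z k - u k) \<le> a n * (\<Sum>k<Suc n. z k - u k)"
      using le[OF Suc.prems] a(2) by (intro mult_right_mono) (auto simp: sum_subtractf)
    then show ?case
      using Suc by (simp add: algebra_simps)
  qed simp
  from this[of N] have "a N * (\<Sum>k<N. z k - u k) \<le> (\<Sum>k<N. a k * z k) - (\<Sum>k<N. a k * u k)"
    by (simp add: right_diff_distrib sum_subtractf)
  moreover have "0 \<le> a N * (\<Sum>k<N. z k - u k)"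
    using le[of N] a(1) by (simp add: sum_subtractf)
  ultimately show ?thesis by simp
qed

text \<open>Using the previous lemma once for \<open>a\<close> and once for \<open>b\<close> reduces
  both weights to indicators of initial segments. What remains is that an n by q corner of
  \<open>D\<close> has mass at most min n q: at most n by the row sums, at most q by the column
  sums.\<close>

lemma substochastic_rearrangement:
  fixes a b :: "nat \<Rightarrow> real" and D :: "nat \<Rightarrow> nat \<Rightarrow> real"
  assumes a: "\<And>k. 0 \<le> a k" "\<And>k. a (Suc k) \<le> a k"
    and b: "\<And>k. 0 \<le> b k" "\<And>k. b (Suc k) \<le> b k"
    and D: "\<And>k m. 0 \<le> D k m"
    and rows: "\<And>k. (\<Sum>m<N. D k m) \<le> 1" and cols: "\<And>m. (\<Sum>k<N. D k m) \<le> 1"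
  shows "(\<Sum>k<N. \<Sum>m<N. D k m * (a k * b m)) \<le> (\<Sum>k<N. a k * b k)"
proof -
  have "(\<Sum>k<n. \<Sum>m<N. D k m * b m) \<le> (\<Sum>k<n. b k)" if n: "n \<le> N" for n
  proof -
    have "(\<Sum>k<n. \<Sum>m<N. D k m * b m) = (\<Sum>m<N. b m * (\<Sum>k<n. D k m))"
      by (subst sum.swap) (simp add: sum_distrib_left mult.commute)
    also have "\<dots> \<le> (\<Sum>m<N. b m * (if m < n then 1 else 0))"
    proof (rule weighted_sum_mono_antimono[where a = b])
      fix q assume "q \<le> N"
      have "(\<Sum>m<q. \<Sum>k<n. D k m) \<le> (\<Sum>m<q. \<Sum>k<N. D k m)"
        using n D by (intro sum_mono sum_mono2) auto
      also have "\<dots> \<le> (\<Sum>m<q. 1)"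
        by (intro sum_mono cols)
      finally have 1: "(\<Sum>m<q. \<Sum>k<n. D k m) \<le> real q" by simp
      have "(\<Sum>m<q. \<Sum>k<n. D k m) = (\<Sum>k<n. \<Sum>m<q. D k m)"
        by (rule sum.swap)
      also have "\<dots> \<le> (\<Sum>k<n. \<Sum>m<N. D k m)"
        using \<open>q \<le> N\<close> D by (intro sum_mono sum_mono2) auto
      also have "\<dots> \<le> (\<Sum>k<n. 1)"
        by (intro sum_mono rows)
      finally have 2: "(\<Sum>m<q. \<Sum>k<n. D k m) \<le> real n" by simp
      have "(\<Sum>m<q. if m < n then 1 else 0 :: real) = (\<Sum>m\<in>{..<min q n}. 1)"
        by (rule sum.mono_neutral_cong_right) auto
      then show "(\<Sum>m<q. \<Sum>k<n. D k m) \<le> (\<Sum>m<q. if m < n then 1 else 0)"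
        using 1 2 by (simp add: min_def)
    qed (fact b)+
    also have "\<dots> = (\<Sum>k<n. b k)"
      using n by (intro sum.mono_neutral_cong_right) auto
    finally show ?thesis .
  qed
  from weighted_sum_mono_antimono[where a = a, OF a this]
  show ?thesis
    by (simp add: sum_distrib_left ac_simps)
qed

subsection \<open>Square-integrable random vectors\<close>

lemma (in prob_space) integrable_mult_self_product:
  fixes H K :: "'a \<Rightarrow> real"
  assumes H: "integrable M H" and K: "integrable M K"
  shows "integrable (M \<Otimes>\<^sub>M M) (\<lambda>(x, y). H x * K y)"
    and "(\<integral>(x, y). H x * K y \<partial>(M \<Otimes>\<^sub>M M)) = (\<integral>x. H x \<partial>M) * (\<integral>y. K y \<partial>M)"
proof -
  interpret pair_sigma_finite M M ..
  note [measurable] = borel_measurable_integrable[OF H] borel_measurable_integrable[OF K]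
  show int: "integrable (M \<Otimes>\<^sub>M M) (\<lambda>(x, y). H x * K y)"
    using H K by (intro Fubini_integrable) (auto simp: abs_mult)
  show "(\<integral>(x, y). H x * K y \<partial>(M \<Otimes>\<^sub>M M)) = (\<integral>x. H x \<partial>M) * (\<integral>y. K y \<partial>M)"
    using integral_fst'[OF int] by simp
qed

lemma integrable_mult_square_integrable:
  fixes U V :: "'a \<Rightarrow> real"
  assumes [measurable]: "U \<in> borel_measurable M" "V \<in> borel_measurable M"
    and "integrable M (\<lambda>x. (U x)\<^sup>2)" "integrable M (\<lambda>x. (V x)\<^sup>2)"
  shows "integrable M (\<lambda>x. U x * V x)"
proof (rule Bochner_Integration.integrable_bound)
  show "integrable M (\<lambda>x. (U x)\<^sup>2 + (V x)\<^sup>2)"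
    using assms by simp
  have "\<bar>u * v\<bar> \<le> u\<^sup>2 + v\<^sup>2" for u v :: real
  proof -
    have "2 * \<bar>u * v\<bar> \<le> u\<^sup>2 + v\<^sup>2"
      using sum_squares_bound[of "\<bar>u\<bar>" "\<bar>v\<bar>"] by (simp add: abs_mult mult.assoc)
    then show ?thesis
      using abs_ge_zero[of "u * v"] by linarith
  qed
  then show "AE x in M. norm (U x * V x) \<le> norm ((U x)\<^sup>2 + (V x)\<^sup>2)"
    by simp
qed measurable

lemma bessel_orthogonal_random_variables:
  fixes U :: "'a \<Rightarrow> real" and Y :: "nat \<Rightarrow> 'a \<Rightarrow> real"
  assumes UU: "integrable M (\<lambda>x. U x * U x)"
    and UY: "\<And>m. integrable M (\<lambda>x. U x * Y m x)"
    and YY: "\<And>m n. integrable M (\<lambda>x. Y m x * Y n x)"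
    and orth: "\<And>m n. (\<integral>x. Y m x * Y n x \<partial>M) = (if m = n then b m else 0)"
  shows "(\<Sum>m<N. (\<integral>x. U x * Y m x \<partial>M)\<^sup>2 / b m) \<le> (\<integral>x. U x * U x \<partial>M)"
proof -
  define c where "c m = (\<integral>x. U x * Y m x \<partial>M)" for m
  \<comment> \<open>The least-squares coefficients. If \<open>b m = 0\<close> then
    \<open>t m = 0\<close>, so such terms drop out and \<open>t m * t m * b m = t m * c m\<close>
    still holds.\<close>
  define t where "t m = c m / b m" for m
  have expand: "(U x - (\<Sum>m<N. t m * Y m x))\<^sup>2 =
      U x * U x - 2 * (\<Sum>m<N. t m * (U x * Y m x)) + (\<Sum>m<N. \<Sum>n<N. (t m * t n) * (Y m x * Y n x))" for x
    by (simp add: power2_eq_square algebra_simps sum_distrib_left sum_distrib_right sum_product)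
  have "0 \<le> (\<integral>x. (U x - (\<Sum>m<N. t m * Y m x))\<^sup>2 \<partial>M)"
    by simp
  also have "\<dots> = (\<integral>x. U x * U x \<partial>M) - 2 * (\<Sum>m<N. t m * c m) +
      (\<Sum>m<N. \<Sum>n<N. (t m * t n) * (if m = n then b m else 0))"
    unfolding expand c_def orth[symmetric]
    using UU UY YY by simp
  also have "(\<Sum>m<N. \<Sum>n<N. (t m * t n) * (if m = n then b m else 0)) = (\<Sum>m<N. t m * t m * b m)"
    by (intro sum.cong) (auto simp: if_distrib cong: if_cong)
  also have "\<dots> = (\<Sum>m<N. t m * c m)"
    by (intro sum.cong) (auto simp: t_def)
  finally have "(\<Sum>m<N. t m * c m) \<le> (\<integral>x. U x * U x \<partial>M)"
    by simp
  then show ?thesis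
    by (simp add: t_def c_def power2_eq_square)
qed

lemma integral_mult_eq_0:
  fixes U V :: "'a \<Rightarrow> real"
  assumes "integrable M (\<lambda>x. U x * U x)" "(\<integral>x. U x * U x \<partial>M) = 0"
  shows "(\<integral>x. U x * V x \<partial>M) = 0"
proof -
  have "AE x in M. U x * U x = 0"
    using integral_nonneg_eq_0_iff_AE[OF assms(1)] assms(2) by simp
  then have "AE x in M. U x * V x = 0"
    by eventually_elim simp
  then show ?thesis
    by (rule integral_eq_zero_AE)
qed

lemma cross_covariance_le:
  fixes X Y :: "nat \<Rightarrow> 'a \<Rightarrow> real"
  assumes XX: "\<And>m n. integrable M (\<lambda>x. X m x * X n x)"
    and XY: "\<And>m n. integrable M (\<lambda>x. X m x * Y n x)"
    and YY: "\<And>m n. integrable M (\<lambda>x. Y m x * Y n x)"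
    and X_orth: "\<And>m n. (\<integral>x. X m x * X n x \<partial>M) = (if m = n then a m else 0)"
    and Y_orth: "\<And>m n. (\<integral>x. Y m x * Y n x \<partial>M) = (if m = n then b m else 0)"
    and a: "\<And>k. 0 \<le> a k" "\<And>k. a (Suc k) \<le> a k"
    and b: "\<And>k. 0 \<le> b k" "\<And>k. b (Suc k) \<le> b k"
  shows "(\<Sum>k<N. \<Sum>m<N. (\<integral>x. X k x * Y m x \<partial>M)\<^sup>2) \<le> (\<Sum>k<N. a k * b k)"
proof -
  define c where "c k m = (\<integral>x. X k x * Y m x \<partial>M)" for k m
  have YX: "integrable M (\<lambda>x. Y m x * X k x)" for k m
    using XY[of k m] by (simp add: mult.commute)
  have c_sym: "c k m = (\<integral>x. Y m x * X k x \<partial>M)" for k m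
    by (simp add: c_def mult.commute)
  \<comment> \<open>Bessel for \<open>X k\<close> against the family \<open>Y\<close>, and below for
    \<open>Y m\<close> against \<open>X\<close>; dividing by \<open>a k\<close> and
    \<open>b m\<close> gives the row and column sums of \<open>D\<close>.\<close>
  have row: "(\<Sum>m<N. (c k m)\<^sup>2 / b m) \<le> a k" for k
    using bessel_orthogonal_random_variables[OF XX[of k k] XY YY Y_orth, of N] X_orth[of k k]
    by (simp add: c_def)
  have col: "(\<Sum>k<N. (c k m)\<^sup>2 / a k) \<le> b m" for m
    using bessel_orthogonal_random_variables[OF YY[of m m] YX XX X_orth, of N] Y_orth[of m m]
    by (simp add: c_sym)
  have a0: "c k m = 0" if "a k = 0" for k m
    unfolding c_def by (rule integral_mult_eq_0[OF XX]) (simp add: X_orth that)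
  have b0: "c k m = 0" if "b m = 0" for k m
    unfolding c_sym by (rule integral_mult_eq_0[OF YY]) (simp add: Y_orth that)
  \<comment> \<open>At a zero eigenvalue the quotient is 0; \<open>a0\<close> and \<open>b0\<close>
    make \<open>c k m\<close> vanish there, so \<open>D k m * (a k * b m)\<close> is the square of
    \<open>c k m\<close> in all cases.\<close>
  define D where "D k m = (c k m)\<^sup>2 / (a k * b m)" for k m
  have "(\<Sum>k<N. \<Sum>m<N. D k m * (a k * b m)) \<le> (\<Sum>k<N. a k * b k)"
  proof (rule substochastic_rearrangement[where a = a and b = b])
    show "0 \<le> D k m" for k m
      using a b by (simp add: D_def)
    show "(\<Sum>m<N. D k m) \<le> 1" for k
    proof -
      have "(\<Sum>m<N. D k m) = (\<Sum>m<N. (c k m)\<^sup>2 / b m) / a k"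
        by (simp add: D_def sum_divide_distrib ac_simps)
      also have "\<dots> \<le> 1"
        using row[of k] a(1)[of k] by (cases "a k = 0") (auto simp: divide_le_eq)
      finally show ?thesis .
    qed
    show "(\<Sum>k<N. D k m) \<le> 1" for m
    proof -
      have "(\<Sum>k<N. D k m) = (\<Sum>k<N. (c k m)\<^sup>2 / a k) / b m"
        by (simp add: D_def sum_divide_distrib)
      also have "\<dots> \<le> 1"
        using col[of m] b(1)[of m] by (cases "b m = 0") (auto simp: divide_le_eq)
      finally show ?thesis .
    qed
  qed (fact a b)+
  moreover have "D k m * (a k * b m) = (c k m)\<^sup>2" for k m
    using a0 b0 by (cases "a k = 0 \<or> b m = 0") (auto simp: D_def)
  ultimately show ?thesis
    by (simp add: c_def)
qed

text \<open>A bound uniform in \<open>n\<close>, which makes truncated inner products eligible for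
  dominated convergence.\<close>

lemma (in padded_basis) partial_parseval_le:
  "\<bar>\<Sum>k<n. (e k \<bullet> x) * (e k \<bullet> y)\<bar> \<le> norm x * norm y"
proof -
  have "(\<Sum>k<n. (e k \<bullet> x) * (e k \<bullet> y))\<^sup>2 \<le> (\<Sum>k<n. (e k \<bullet> x)\<^sup>2) * (\<Sum>k<n. (e k \<bullet> y)\<^sup>2)"
    by (rule Cauchy_Schwarz_ineq_sum)
  also have "\<dots> \<le> (norm x)\<^sup>2 * (norm y)\<^sup>2"
    by (intro mult_mono bessel) (auto intro: sum_nonneg)
  finally have "\<bar>\<Sum>k<n. (e k \<bullet> x) * (e k \<bullet> y)\<bar>\<^sup>2 \<le> (norm x * norm y)\<^sup>2"
    by (simp add: power_mult_distrib)
  then show ?thesis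
    by (rule power2_le_imp_le) simp
qed

text \<open>The limit is the squared Hilbert--Schmidt norm of the cross-covariance operator of
  \<open>f\<close> and \<open>g\<close>.\<close>

lemma (in prob_space) inner_products_independent_copy:
  fixes f :: "'a \<Rightarrow> 'b::{real_inner, second_countable_topology}"
    and g :: "'a \<Rightarrow> 'c::{real_inner, second_countable_topology}"
  assumes [measurable]: "f \<in> borel_measurable M" "g \<in> borel_measurable M"
    and f: "integrable M (\<lambda>x. (norm (f x))\<^sup>2)" and g: "integrable M (\<lambda>x. (norm (g x))\<^sup>2)"
    and "padded_basis e" "padded_basis d"
  shows "integrable (M \<Otimes>\<^sub>M M) (\<lambda>(x, y). (f x \<bullet> f y) * (g x \<bullet> g y))"
    and "(\<lambda>N. \<Sum>k<N. \<Sum>m<N. (\<integral>x. (e k \<bullet> f x) * (d m \<bullet> g x) \<partial>M)\<^sup>2)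
      \<longlonglongrightarrow> (\<integral>(x, y). (f x \<bullet> f y) * (g x \<bullet> g y) \<partial>(M \<Otimes>\<^sub>M M))"
proof -
  interpret e: padded_basis e by fact
  interpret d: padded_basis d by fact
  have H: "integrable M (\<lambda>x. norm (f x) * norm (g x))"
    using f g by (intro integrable_mult_square_integrable) auto
  define W where "W = (\<lambda>(x, y). (norm (f x) * norm (g x)) * (norm (f y) * norm (g y)))"
  have W: "integrable (M \<Otimes>\<^sub>M M) W"
    unfolding W_def by (rule integrable_mult_self_product[OF H H])
  show "integrable (M \<Otimes>\<^sub>M M) (\<lambda>(x, y). (f x \<bullet> f y) * (g x \<bullet> g y))"
  proof (rule Bochner_Integration.integrable_bound[OF W])
    have "\<bar>(f x \<bullet> f y) * (g x \<bullet> g y)\<bar> \<le> W (x, y)" for x y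
      using mult_mono[OF Cauchy_Schwarz_ineq2[of "f x" "f y"] Cauchy_Schwarz_ineq2[of "g x" "g y"]]
      by (simp add: W_def abs_mult ac_simps)
    then show "AE z in M \<Otimes>\<^sub>M M. norm (case z of (x, y) \<Rightarrow> (f x \<bullet> f y) * (g x \<bullet> g y)) \<le> norm (W z)"
      by (intro AE_I2) (auto simp: order_trans[OF _ abs_ge_self])
  qed measurable
  have comp: "integrable M (\<lambda>x. (e k \<bullet> f x) * (d m \<bullet> g x))" for k m
  proof (rule Bochner_Integration.integrable_bound[OF H])
    have "\<bar>e k \<bullet> z\<bar> \<le> norm z" for z
      by (rule power2_le_imp_le) (use e.bessel[of "{k}" z] in auto)
    moreover have "\<bar>d m \<bullet> z\<bar> \<le> norm z" for z
      by (rule power2_le_imp_le) (use d.bessel[of "{m}" z] in auto)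
    ultimately show "AE x in M. norm ((e k \<bullet> f x) * (d m \<bullet> g x)) \<le> norm (norm (f x) * norm (g x))"
      by (intro AE_I2) (auto simp: abs_mult intro!: mult_mono)
  qed measurable
  \<comment> \<open>Truncating both inner products leaves a finite sum of terms H(x) H(y), and by
    independence of the two copies each integrates to the square of a cross-covariance
    entry.\<close>
  define F where "F N = (\<lambda>(x, y). (\<Sum>k<N. (e k \<bullet> f x) * (e k \<bullet> f y)) * (\<Sum>m<N. (d m \<bullet> g x) * (d m \<bullet> g y)))" for N
  have "(\<integral>z. F N z \<partial>(M \<Otimes>\<^sub>M M)) = (\<Sum>k<N. \<Sum>m<N. (\<integral>x. (e k \<bullet> f x) * (d m \<bullet> g x) \<partial>M)\<^sup>2)" for N
  proof -
    have "F N z = (\<Sum>k<N. \<Sum>m<N. (case z of (x, y) \<Rightarrow> ((e k \<bullet> f x) * (d m \<bullet> g x)) * ((e k \<bullet> f y) * (d m \<bullet> g y))))" for z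
      by (cases z) (simp add: F_def sum_product ac_simps)
    then show ?thesis
      by (simp add: integrable_mult_self_product[OF comp comp] power2_eq_square)
  qed
  moreover have "(\<lambda>N. \<integral>z. F N z \<partial>(M \<Otimes>\<^sub>M M)) \<longlonglongrightarrow>
      (\<integral>(x, y). (f x \<bullet> f y) * (g x \<bullet> g y) \<partial>(M \<Otimes>\<^sub>M M))"
  proof (rule integral_dominated_convergence[OF _ _ W])
    show "AE z in M \<Otimes>\<^sub>M M. (\<lambda>N. F N z) \<longlonglongrightarrow> (case z of (x, y) \<Rightarrow> (f x \<bullet> f y) * (g x \<bullet> g y))"
      using e.parseval d.parseval unfolding sums_def F_def
      by (intro AE_I2) (auto intro!: tendsto_mult)
    have "\<bar>F N (x, y)\<bar> \<le> W (x, y)" for N x y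
      using mult_mono[OF e.partial_parseval_le[of "f x" "f y" N] d.partial_parseval_le[of "g x" "g y" N]]
      by (simp add: F_def W_def abs_mult ac_simps)
    then show "AE z in M \<Otimes>\<^sub>M M. norm (F N z) \<le> W z" for N
      by (intro AE_I2) auto
  qed (unfold F_def, measurable)
  ultimately show "(\<lambda>N. \<Sum>k<N. \<Sum>m<N. (\<integral>x. (e k \<bullet> f x) * (d m \<bullet> g x) \<partial>M)\<^sup>2)
      \<longlonglongrightarrow> (\<integral>(x, y). (f x \<bullet> f y) * (g x \<bullet> g y) \<partial>(M \<Otimes>\<^sub>M M))"
    by simp
qed

text \<open>By Parseval and termwise integration of nonnegative terms, the second moment of the norm
  is the trace of \<open>A\<close>.\<close>

lemma (in padded_basis) gaussian_norm_square_integrable: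
  fixes \<mu> :: "'a measure"
  assumes \<mu>: "is_gaussian A \<mu>" and trace: "summable (\<lambda>k. e k \<bullet> A (e k))"
  shows "integrable \<mu> (\<lambda>x. (norm x)\<^sup>2)"
proof (rule integrableI_nonneg)
  have sets: "sets \<mu> = sets borel" and pos: "\<And>h. 0 \<le> h \<bullet> A h"
    using \<mu> unfolding is_gaussian_def covariance_operator_def positive_operator_def by auto
  note [measurable] = measurable_inner_const[OF sets]
  show "(\<lambda>x. (norm x)\<^sup>2) \<in> borel_measurable \<mu>"
    using sets by (simp add: measurable_cong_sets[OF sets refl] borel_measurable_power borel_measurable_norm)
  have "(\<integral>\<^sup>+x. ennreal ((norm x)\<^sup>2) \<partial>\<mu>) = (\<integral>\<^sup>+x. (\<Sum>k. ennreal ((e k \<bullet> x)\<^sup>2)) \<partial>\<mu>)"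
  proof (intro nn_integral_cong)
    show "ennreal ((norm x)\<^sup>2) = (\<Sum>k. ennreal ((e k \<bullet> x)\<^sup>2))" for x
      by (rule suminf_ennreal_eq[OF _ parseval_norm, symmetric]) simp
  qed
  also have "\<dots> = (\<Sum>k. \<integral>\<^sup>+x. ennreal ((e k \<bullet> x)\<^sup>2) \<partial>\<mu>)"
    by (intro nn_integral_suminf) measurable
  also have "\<dots> = (\<Sum>k. ennreal (e k \<bullet> A (e k)))"
    using gaussian_second_moment[OF \<mu>]
    by (intro suminf_cong) (simp add: nn_integral_eq_integral power2_eq_square)
  also have "\<dots> < \<infinity>"
    using pos trace by (simp add: suminf_ennreal2)
  finally show "(\<integral>\<^sup>+x. ennreal ((norm x)\<^sup>2) \<partial>\<mu>) < \<infinity>" .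
qed simp

subsection \<open>The comonotone Gaussian coupling\<close>

lemma borel_measurable_vec_nth:
  "(\<lambda>x. x $ i) \<in> borel_measurable (borel :: ('h::real_normed_vector ^ 'p::finite) measure)"
  by (intro borel_measurable_continuous_onI linear_continuous_on bounded_linear_vec_nth)

text \<open>In an eigenbasis the coordinates are uncorrelated with the eigenvalues as variances;
  \<open>zero\<close> makes this true at padding indices as well.\<close>

lemma padded_basis_moments:
  fixes e :: "nat \<Rightarrow> 'h::{real_inner, banach, second_countable_topology}"
  assumes \<mu>: "is_gaussian A \<mu>" and basis: "padded_basis e"
    and eig: "\<And>k x. e k \<bullet> A x = a k * (e k \<bullet> x)" and zero: "\<And>k. e k = 0 \<Longrightarrow> a k = 0"
    and trace: "summable a"
  shows "integrable \<mu> (\<lambda>x. (norm x)\<^sup>2)"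
    and "(\<integral>x. (e k \<bullet> x) * (e m \<bullet> x) \<partial>\<mu>) = (if k = m then a k else 0)"
proof -
  interpret padded_basis e by (rule basis)
  have *: "e k \<bullet> A (e m) = (if k = m then a k else 0)" for k m
    using zero by (auto simp: eig inner_basis)
  show "integrable \<mu> (\<lambda>x. (norm x)\<^sup>2)"
    by (rule gaussian_norm_square_integrable[OF \<mu>]) (simp add: * trace)
  show "(\<integral>x. (e k \<bullet> x) * (e m \<bullet> x) \<partial>\<mu>) = (if k = m then a k else 0)"
    by (simp add: gaussian_second_moment[OF \<mu>] *)
qed

section \<open>The cost as a function of the cross-covariances, and its minimiser\<close>

lemma igw_cost_eq:
  fixes \<gamma> :: "('h::{real_inner, banach, second_countable_topology}, 'p::{finite,linorder}) vec measure"
  assumes \<gamma>: "prob_space \<gamma>" "sets \<gamma> = sets borel"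
    and int: "\<And>i j. integrable (\<gamma> \<Otimes>\<^sub>M \<gamma>) (\<lambda>(x, y). (x $ i \<bullet> y $ i) * (x $ j \<bullet> y $ j))"
    and C: "\<And>i j. C i j = (\<integral>(x, y). (x $ i \<bullet> y $ i) * (x $ j \<bullet> y $ j) \<partial>(\<gamma> \<Otimes>\<^sub>M \<gamma>))"
  shows "igw_cost \<gamma> = ennreal (\<Sum>i\<in>UNIV. \<Sum>j\<in>{i<..}. C i i + C j j - 2 * C i j)"
proof -
  define R where "R i j z = (fst z $ i \<bullet> snd z $ i) * (fst z $ j \<bullet> snd z $ j)"
    for i j and z :: "('h, 'p) vec \<times> ('h, 'p) vec"
  have int': "integrable (\<gamma> \<Otimes>\<^sub>M \<gamma>) (R i j)" and C': "(\<integral>z. R i j z \<partial>(\<gamma> \<Otimes>\<^sub>M \<gamma>)) = C i j" for i j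
  proof -
    have R: "R i j = (\<lambda>(x, y). (x $ i \<bullet> y $ i) * (x $ j \<bullet> y $ j))"
      by (auto simp: R_def)
    show "integrable (\<gamma> \<Otimes>\<^sub>M \<gamma>) (R i j)" "(\<integral>z. R i j z \<partial>(\<gamma> \<Otimes>\<^sub>M \<gamma>)) = C i j"
      unfolding R by (rule int, rule C[symmetric])
  qed
  have "igw_cost \<gamma> = (\<integral>\<^sup>+z. ennreal (\<Sum>i\<in>UNIV. \<Sum>j\<in>{i<..}. R i i z + R j j z - 2 * R i j z) \<partial>(\<gamma> \<Otimes>\<^sub>M \<gamma>))"
    unfolding igw_cost_def
    by (intro nn_integral_cong) (simp add: R_def split_beta power2_eq_square algebra_simps)
  also have "\<dots> = ennreal (\<integral>z. (\<Sum>i\<in>UNIV. \<Sum>j\<in>{i<..}. R i i z + R j j z - 2 * R i j z) \<partial>(\<gamma> \<Otimes>\<^sub>M \<gamma>))"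
  proof (rule nn_integral_eq_integral)
    show "integrable (\<gamma> \<Otimes>\<^sub>M \<gamma>) (\<lambda>z. \<Sum>i\<in>UNIV. \<Sum>j\<in>{i<..}. R i i z + R j j z - 2 * R i j z)"
      using int' by simp
    have "R i i z + R j j z - 2 * R i j z = (fst z $ i \<bullet> snd z $ i - fst z $ j \<bullet> snd z $ j)\<^sup>2" for i j z
      by (simp add: R_def power2_eq_square algebra_simps)
    then show "AE z in \<gamma> \<Otimes>\<^sub>M \<gamma>. 0 \<le> (\<Sum>i\<in>UNIV. \<Sum>j\<in>{i<..}. R i i z + R j j z - 2 * R i j z)"
      by (simp add: sum_nonneg)
  qed
  also have "(\<integral>z. (\<Sum>i\<in>UNIV. \<Sum>j\<in>{i<..}. R i i z + R j j z - 2 * R i j z) \<partial>(\<gamma> \<Otimes>\<^sub>M \<gamma>)) =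
      (\<Sum>i\<in>UNIV. \<Sum>j\<in>{i<..}. C i i + C j j - 2 * C i j)"
    using int' by (simp add: C')
  finally show ?thesis .
qed

text \<open>Unitaries, adjoints and operator roots are replaced by the matrix entries in hypothesis
  \<open>B\<close>. For \<open>i = j\<close> it says that \<open>e i\<close> diagonalises
  \<open>B i i\<close> with eigenvalues \<open>a i\<close>.\<close>

theorem comonotone_gaussian_solves_igw:
  fixes \<mu> :: "'p::{finite,linorder} \<Rightarrow> 'h::{real_inner, banach, second_countable_topology} measure"
    and e :: "'p \<Rightarrow> nat \<Rightarrow> 'h" and a :: "'p \<Rightarrow> nat \<Rightarrow> real" and B :: "'p \<Rightarrow> 'p \<Rightarrow> 'h \<Rightarrow> 'h"
  assumes \<mu>: "\<And>i. is_gaussian (B i i) (\<mu> i)"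
    and basis: "\<And>i. padded_basis (e i)"
    and B: "\<And>i j k x. e i k \<bullet> B i j x = sqrt (a i k) * sqrt (a j k) * (e j k \<bullet> x)"
    and zero: "\<And>i k. e i k = 0 \<Longrightarrow> a i k = 0"
    and nonneg: "\<And>i k. 0 \<le> a i k" and dec: "\<And>i k. a i (Suc k) \<le> a i k"
    and trace: "\<And>i. summable (a i)"
  shows "\<exists>\<pi>. is_gaussian (block_operator B) \<pi>"
    and "is_gaussian (block_operator B) \<pi> \<Longrightarrow> solves_multimarginal_igw \<mu> \<pi>"
proof -
  interpret e: padded_basis "e i" for i by (rule basis)
  \<comment> \<open>The k-th eigendirections of all components, scaled by their standard deviations
    and bundled into one vector, so that they share one noise.\<close>
  define w :: "nat \<Rightarrow> ('h, 'p) vec" where "w k = (\<chi> i. sqrt (a i k) *\<^sub>R e i k)" for k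
  define A where "A x = (\<Sum>k. (w k \<bullet> x) *\<^sub>R w k)" for x
  have w_axis: "w k \<bullet> axis i h = sqrt (a i k) * (e i k \<bullet> h)" for k i h
    by (simp add: w_def inner_axis)
  have w_orth: "w j \<bullet> w k = 0" if "j \<noteq> k" for j k
    using e.orth[OF that] by (simp add: w_def inner_vec_def)
  have w_sq: "summable (\<lambda>k. (norm (w k))\<^sup>2)"
  proof -
    have "(norm (w k))\<^sup>2 = (\<Sum>i\<in>UNIV. a i k)" for k
      using zero nonneg
      by (auto simp: power2_norm_eq_inner w_def inner_vec_def e.inner_basis intro!: sum.cong)
    then show ?thesis
      using trace by (simp add: summable_sum)
  qed
  note A_inner = covariance_operator_series(3)[OF w_sq, folded A_def]
  have eig: "e i k \<bullet> B i i x = a i k * (e i k \<bullet> x)" for i k x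
    using nonneg by (simp add: B)
  have A_block: "A = block_operator B"
  proof
    fix x
    have "A x $ i = block_operator B x $ i" for i
    proof (rule e.eq_if_inner_basis_eq[of i])
      fix k
      \<comment> \<open>Orthogonality leaves only the term \<open>n = k\<close>. If
        \<open>e i k = 0\<close>, then \<open>a i k = 0\<close> and both sides vanish.\<close>
      have "axis i (e i k) \<bullet> A x = sqrt (a i k) * (w k \<bullet> x)"
      proof (rule sums_unique2[OF A_inner])
        have "(w n \<bullet> axis i (e i k)) * (w n \<bullet> x) = (if n = k then sqrt (a i k) * (w k \<bullet> x) else 0)" for n
          using zero[of i k] unfolding w_axis by (auto simp: e.inner_basis)
        then show "(\<lambda>n. (w n \<bullet> axis i (e i k)) * (w n \<bullet> x)) sums (sqrt (a i k) * (w k \<bullet> x))"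
          using sums_single[of k "\<lambda>_. sqrt (a i k) * (w k \<bullet> x)"] by simp
      qed
      also have "\<dots> = e i k \<bullet> block_operator B x $ i"
        by (simp add: block_operator_def inner_sum_right B w_def inner_vec_def sum_distrib_left ac_simps)
      finally show "e i k \<bullet> A x $ i = e i k \<bullet> block_operator B x $ i"
        by (simp only: inner_axis')
    qed
    then show "A x = block_operator B x"
      by (simp add: vec_eq_iff)
  qed
  show "\<exists>\<pi>. is_gaussian (block_operator B) \<pi>"
    using exists_gaussian_series[OF w_orth w_sq] unfolding A_block[symmetric] A_def .
  \<comment> \<open>All that is needed about a coupling, proved once and then used both for
    \<open>\<pi>\<close> and for an arbitrary competitor: the diagonal of \<open>C\<close> is
    determined by the marginals, and the truncations converging to the other entries are
    bounded.\<close>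
  have coupled: "\<exists>C. igw_cost \<gamma> = ennreal (\<Sum>i\<in>UNIV. \<Sum>j\<in>{i<..}. C i i + C j j - 2 * C i j) \<and>
      (\<forall>i j. (\<lambda>N. \<Sum>k<N. \<Sum>m<N. (\<integral>x. (e i k \<bullet> x $ i) * (e j m \<bullet> x $ j) \<partial>\<gamma>)\<^sup>2) \<longlonglongrightarrow> C i j) \<and>
      (\<forall>i. (\<lambda>N. \<Sum>k<N. a i k * a i k) \<longlonglongrightarrow> C i i) \<and>
      (\<forall>i j N. (\<Sum>k<N. \<Sum>m<N. (\<integral>x. (e i k \<bullet> x $ i) * (e j m \<bullet> x $ j) \<partial>\<gamma>)\<^sup>2) \<le> (\<Sum>k<N. a i k * a j k))"
    if \<gamma>: "\<gamma> \<in> couplings \<mu>" for \<gamma>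
  proof -
    have prob: "prob_space \<gamma>" and sets: "sets \<gamma> = sets borel"
      and marg: "\<And>i. distr \<gamma> borel (\<lambda>x. x $ i) = \<mu> i"
      using \<gamma> by (auto simp: couplings_def)
    interpret prob_space \<gamma> by (rule prob)
    have [measurable]: "(\<lambda>x. x $ i) \<in> borel_measurable \<gamma>" for i
      using borel_measurable_vec_nth measurable_cong_sets[OF sets refl] by blast
    have norm_int: "integrable \<gamma> (\<lambda>x. (norm (x $ i))\<^sup>2)" for i
    proof -
      have "integrable (distr \<gamma> borel (\<lambda>x. x $ i)) (\<lambda>x. (norm x)\<^sup>2)"
        unfolding marg by (rule padded_basis_moments(1)[OF \<mu> basis eig zero trace])
      then show ?thesis
        by (simp add: integrable_distr_eq)
    qed
    have comp_int: "integrable \<gamma> (\<lambda>x. (e i k \<bullet> x $ i) * (e j m \<bullet> x $ j))" for i j k m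
    proof -
      have "integrable \<gamma> (\<lambda>x. (e i k \<bullet> x $ i)\<^sup>2)" for i k
      proof (rule Bochner_Integration.integrable_bound[OF norm_int[of i]])
        show "AE x in \<gamma>. norm ((e i k \<bullet> x $ i)\<^sup>2) \<le> norm ((norm (x $ i))\<^sup>2)"
          using e.bessel[of "{k}" i] by simp
      qed measurable
      then show ?thesis
        by (intro integrable_mult_square_integrable) measurable
    qed
    have orth: "(\<integral>x. (e i k \<bullet> x $ i) * (e i m \<bullet> x $ i) \<partial>\<gamma>) = (if k = m then a i k else 0)" for i k m
    proof -
      have "(\<integral>x. (e i k \<bullet> x) * (e i m \<bullet> x) \<partial>distr \<gamma> borel (\<lambda>x. x $ i)) = (if k = m then a i k else 0)"
        unfolding marg by (rule padded_basis_moments(2)[OF \<mu> basis eig zero trace])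
      then show ?thesis
        by (simp add: integral_distr)
    qed
    define C where "C i j = (\<integral>(x, y). (x $ i \<bullet> y $ i) * (x $ j \<bullet> y $ j) \<partial>(\<gamma> \<Otimes>\<^sub>M \<gamma>))" for i j
    note indep_copy = inner_products_independent_copy[OF _ _ norm_int norm_int basis basis]
    have lim: "(\<lambda>N. \<Sum>k<N. \<Sum>m<N. (\<integral>x. (e i k \<bullet> x $ i) * (e j m \<bullet> x $ j) \<partial>\<gamma>)\<^sup>2) \<longlonglongrightarrow> C i j" for i j
      unfolding C_def by (rule indep_copy(2)) measurable
    have "igw_cost \<gamma> = ennreal (\<Sum>i\<in>UNIV. \<Sum>j\<in>{i<..}. C i i + C j j - 2 * C i j)"
    proof (rule igw_cost_eq[OF prob sets _ C_def])
      show "integrable (\<gamma> \<Otimes>\<^sub>M \<gamma>) (\<lambda>(x, y). (x $ i \<bullet> y $ i) * (x $ j \<bullet> y $ j))" for i j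
        by (rule indep_copy(1)) measurable
    qed
    moreover have "(\<lambda>N. \<Sum>k<N. a i k * a i k) \<longlonglongrightarrow> C i i" for i
    proof -
      have "(if k = m then r else 0)\<^sup>2 = (if k = m then r * r else 0)" for k m :: nat and r :: real
        by (simp add: power2_eq_square)
      then show ?thesis
        using lim[of i i] by (simp add: orth)
    qed
    moreover have "(\<Sum>k<N. \<Sum>m<N. (\<integral>x. (e i k \<bullet> x $ i) * (e j m \<bullet> x $ j) \<partial>\<gamma>)\<^sup>2) \<le> (\<Sum>k<N. a i k * a j k)" for i j N
      by (rule cross_covariance_le[OF comp_int comp_int comp_int orth orth nonneg dec nonneg dec])
    ultimately show ?thesis
      using lim by blast
  qed
  assume "is_gaussian (block_operator B) \<pi>"
  then have \<pi>: "is_gaussian A \<pi>"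
    unfolding A_block .
  have prob: "prob_space \<pi>" and sets: "sets \<pi> = sets borel"
    and law: "\<And>h. distr \<pi> borel (\<lambda>x. h \<bullet> x) = normal_law (h \<bullet> A h)"
    using \<pi> by (auto simp: is_gaussian_def)
  have nth [measurable]: "(\<lambda>x. x $ i) \<in> borel_measurable \<pi>" for i
    using borel_measurable_vec_nth measurable_cong_sets[OF sets refl] by blast
  \<comment> \<open>The variance of \<open>h\<close> in the i-th component of \<open>\<pi>\<close>
    is its variance under \<open>\<mu> i\<close>; the projection theorem then identifies the
    marginal.\<close>
  have A_axis: "axis i h \<bullet> A (axis i h) = h \<bullet> B i i h" for i h
  proof (rule sums_unique2[OF A_inner])
    have "(w k \<bullet> axis i h) * (w k \<bullet> axis i h) = (e i k \<bullet> h) * (e i k \<bullet> B i i h)" for k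
    proof -
      have "sqrt (a i k) * sqrt (a i k) = a i k"
        using nonneg by simp
      then show ?thesis
        unfolding w_axis eig by (simp add: ac_simps)
    qed
    then show "(\<lambda>k. (w k \<bullet> axis i h) * (w k \<bullet> axis i h)) sums (h \<bullet> B i i h)"
      using e.parseval[of i h "B i i h"] by simp
  qed
  have "distr \<pi> borel (\<lambda>x. x $ i) = \<mu> i" for i
  proof (rule measure_eqI_projections)
    show "prob_space (distr \<pi> borel (\<lambda>x. x $ i))"
      by (intro prob_space.prob_space_distr prob nth)
    show "prob_space (\<mu> i)" "sets (\<mu> i) = sets borel"
      using \<mu>[of i] by (auto simp: is_gaussian_def)
    fix h
    have "distr (distr \<pi> borel (\<lambda>x. x $ i)) borel (\<lambda>x. h \<bullet> x) = distr \<pi> borel (\<lambda>x. axis i h \<bullet> x)"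
      using nth measurable_inner_const[of borel h]
      by (simp add: distr_distr comp_def inner_axis')
    also have "\<dots> = distr (\<mu> i) borel (\<lambda>x. h \<bullet> x)"
      using \<mu>[of i] by (simp add: law A_axis is_gaussian_def)
    finally show "distr (distr \<pi> borel (\<lambda>x. x $ i)) borel (\<lambda>x. h \<bullet> x) = distr (\<mu> i) borel (\<lambda>x. h \<bullet> x)" .
  qed simp
  then have \<pi>_coupling: "\<pi> \<in> couplings \<mu>"
    using prob sets by (simp add: couplings_def)
  have A_cross: "axis i (e i k) \<bullet> A (axis j (e j m)) = (if k = m then sqrt (a i k) * sqrt (a j k) else 0)" for i j k m
  proof (rule sums_unique2[OF A_inner])
    have "(w n \<bullet> axis i (e i k)) * (w n \<bullet> axis j (e j m)) =
        (if n = k then (if k = m then sqrt (a i k) * sqrt (a j k) else 0) else 0)" for n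
      using zero[of i k] zero[of j k] unfolding w_axis by (auto simp: e.inner_basis)
    then show "(\<lambda>n. (w n \<bullet> axis i (e i k)) * (w n \<bullet> axis j (e j m))) sums
        (if k = m then sqrt (a i k) * sqrt (a j k) else 0)"
      using sums_single[of k "\<lambda>_. if k = m then sqrt (a i k) * sqrt (a j k) else 0"] by simp
  qed
  \<comment> \<open>For \<open>\<pi>\<close> the cross-covariance matrix is diagonal, so the bound
    in \<open>coupled\<close> is an equality for every \<open>N\<close>.\<close>
  have \<pi>_cross: "(\<Sum>k<N. \<Sum>m<N. (\<integral>x. (e i k \<bullet> x $ i) * (e j m \<bullet> x $ j) \<partial>\<pi>)\<^sup>2) = (\<Sum>k<N. a i k * a j k)" for i j N
  proof -
    have "(\<integral>x. (e i k \<bullet> x $ i) * (e j m \<bullet> x $ j) \<partial>\<pi>) = (if k = m then sqrt (a i k) * sqrt (a j k) else 0)" for k m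
      using gaussian_second_moment(2)[OF \<pi>, of "axis i (e i k)" "axis j (e j m)"]
      unfolding A_cross by (simp only: inner_axis')
    then have "(\<integral>x. (e i k \<bullet> x $ i) * (e j m \<bullet> x $ j) \<partial>\<pi>)\<^sup>2 = (if k = m then a i k * a j k else 0)" for k m
      using nonneg by (simp add: power_mult_distrib)
    then show ?thesis
      by simp
  qed
  show "solves_multimarginal_igw \<mu> \<pi>"
    unfolding solves_multimarginal_igw_def
  proof (intro conjI \<pi>_coupling antisym INF_lower INF_greatest)
    fix \<gamma> assume \<gamma>: "\<gamma> \<in> couplings \<mu>"
    obtain C where C: "igw_cost \<gamma> = ennreal (\<Sum>i\<in>UNIV. \<Sum>j\<in>{i<..}. C i i + C j j - 2 * C i j)"
      "\<And>i j. (\<lambda>N. \<Sum>k<N. \<Sum>m<N. (\<integral>x. (e i k \<bullet> x $ i) * (e j m \<bullet> x $ j) \<partial>\<gamma>)\<^sup>2) \<longlonglongrightarrow> C i j"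
      "\<And>i. (\<lambda>N. \<Sum>k<N. a i k * a i k) \<longlonglongrightarrow> C i i"
      "\<And>i j N. (\<Sum>k<N. \<Sum>m<N. (\<integral>x. (e i k \<bullet> x $ i) * (e j m \<bullet> x $ j) \<partial>\<gamma>)\<^sup>2) \<le> (\<Sum>k<N. a i k * a j k)"
      using coupled[OF \<gamma>] by blast
    obtain D where D: "igw_cost \<pi> = ennreal (\<Sum>i\<in>UNIV. \<Sum>j\<in>{i<..}. D i i + D j j - 2 * D i j)"
      "\<And>i j. (\<lambda>N. \<Sum>k<N. a i k * a j k) \<longlonglongrightarrow> D i j"
      using coupled[OF \<pi>_coupling] unfolding \<pi>_cross by blast
    \<comment> \<open>The two costs can differ only in the off-diagonal entries, which enter with
      the factor -2.\<close>
    have "C i i = D i i" for i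
      using C(3)[of i] D(2)[of i i] by (rule LIMSEQ_unique)
    moreover have "C i j \<le> D i j" for i j
      using C(2)[of i j] D(2)[of i j] C(4) by (intro LIMSEQ_le) auto
    ultimately show "igw_cost \<pi> \<le> igw_cost \<gamma>"
      unfolding C(1) D(1) by (intro ennreal_leI sum_mono) simp
  qed
qed

subsection \<open>From spectral decompositions to padded bases\<close>

text \<open>\<open>adjoint\<close> is defined by choice, so its characteristic identity needs a
  witness; surjectivity supplies \<open>inv U\<close>.\<close>

lemma unitary_inner:
  assumes "unitary U"
  shows "U x \<bullet> U y = x \<bullet> y" and "x \<bullet> adjoint U y = U x \<bullet> y" and "linear U"
proof -
  have inner: "\<And>x y. U x \<bullet> U y = x \<bullet> y" and surj: "surj U" and "linear U"
    using assms unfolding unitary_def orthogonal_transformation_def by auto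
  then show "U x \<bullet> U y = x \<bullet> y" "linear U"
    by auto
  have "\<forall>x y. U x \<bullet> y = x \<bullet> inv U y"
    using inner surj_f_inv_f[OF surj] by metis
  then have "adjoint U = inv U"
    by (rule adjoint_unique)
  with \<open>\<forall>x y. U x \<bullet> y = x \<bullet> inv U y\<close> show "x \<bullet> adjoint U y = U x \<bullet> y"
    by simp
qed

lemma orthonormal_basis_unitary:
  assumes v: "orthonormal_basis K v" and U: "unitary U"
  shows "orthonormal_basis K (\<lambda>k. U (v k))"
proof -
  have "orthogonal_transformation U" and surj: "surj U"
    using U by (auto simp: unitary_def)
  then have "continuous_on UNIV U"
    by (intro linear_continuous_on bounded_linear_intro[where K = 1])
      (auto simp: orthogonal_transformation_def linear_add linear_scale norm_eq_sqrt_inner)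
  have "U ` closure (span (v ` K)) \<subseteq> closure (U ` span (v ` K))"
    using \<open>continuous_on UNIV U\<close>
    by (intro image_closure_subset closure_subset closed_closure) (rule continuous_on_subset, auto)
  also have "U ` span (v ` K) = span ((\<lambda>k. U (v k)) ` K)"
    by (simp add: linear_span_image[OF unitary_inner(3)[OF U], symmetric] image_image)
  finally have "closure (span ((\<lambda>k. U (v k)) ` K)) = UNIV"
    using v surj unfolding orthonormal_basis_def by auto
  then show ?thesis
    using v unfolding orthonormal_basis_def by (simp add: unitary_inner(1)[OF U])
qed

text \<open>Summable eigenvalues make the series absolutely convergent, hence its unconditional sum
  over \<open>K\<close> agrees with the ordered series of the padded sequence.\<close>

lemma diagonal_operator_eq_diag:
  fixes v :: "nat \<Rightarrow> 'h::{real_inner, banach}"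
  assumes v: "orthonormal_basis K v" and l: "\<And>k. k \<in> K \<Longrightarrow> 0 \<le> l k"
    and sum: "summable (\<lambda>k. if k \<in> K then l k else 0)"
    and bd: "\<And>k. k \<in> K \<Longrightarrow> l k \<le> C" and "0 \<le> C"
  shows "diagonal_operator K v l =
    hilbert_padded_basis.diag (\<lambda>k. if k \<in> K then v k else 0) (\<lambda>k. if k \<in> K then l k else 0)"
proof
  fix x
  define e where "e k = (if k \<in> K then v k else 0)" for k
  define a where "a k = (if k \<in> K then l k else 0)" for k
  interpret hilbert_padded_basis e
    unfolding e_def hilbert_padded_basis_def by (rule padded_basis_if_orthonormal_basis[OF v])
  have a: "\<bar>a k\<bar> \<le> C" "0 \<le> a k" for k
    using l bd \<open>0 \<le> C\<close> by (auto simp: a_def)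
  have "((\<lambda>k. (a k * (e k \<bullet> x)) *\<^sub>R e k) has_sum diag a x) UNIV"
  proof (rule norm_summable_imp_has_sum[OF _ sums_diag[of a C, OF a(1)]])
    show "summable (\<lambda>k. norm ((a k * (e k \<bullet> x)) *\<^sub>R e k))"
    proof (rule summable_comparison_test'[where N = 0])
      show "summable (\<lambda>k. a k * norm x)"
        using sum by (intro summable_mult2) (simp add: a_def)
      have "norm (e k) \<le> 1" for k
        using inner_basis[of k k] by (auto simp: norm_eq_sqrt_inner)
      then have "\<bar>e k \<bullet> x\<bar> * norm (e k) \<le> norm x" for k
        using bessel[of "{k}" x] mult_mono[of "\<bar>e k \<bullet> x\<bar>" "norm x" "norm (e k)" 1]
        by (simp add: abs_le_square_iff[symmetric])
      then show "norm (norm ((a k * (e k \<bullet> x)) *\<^sub>R e k)) \<le> a k * norm x" for k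
        using a(2)[of k] by (simp add: abs_mult mult.assoc mult_left_mono)
    qed
  qed
  then have "diag a x = (\<Sum>\<^sub>\<infinity>k. (a k * (e k \<bullet> x)) *\<^sub>R e k)"
    by (simp add: infsumI)
  also have "\<dots> = diagonal_operator K v l x"
    unfolding diagonal_operator_def
    by (rule infsum_cong_neutral) (auto simp: a_def e_def rank_one_def)
  finally show "diagonal_operator K v l x =
      hilbert_padded_basis.diag (\<lambda>k. if k \<in> K then v k else 0) (\<lambda>k. if k \<in> K then l k else 0) x"
    by (simp add: e_def[abs_def] a_def[abs_def])
qed

text \<open>In the orthonormal basis \<open>U (v k)\<close> the diagonal entries of \<open>S\<close>
  are the \<open>l k\<close>, so the trace condition in that basis is the claim.\<close>

lemma spectral_data_summable:
  assumes S: "covariance_operator S" and v: "orthonormal_basis K v" and U: "unitary U"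
    and dec: "S = U \<circ> diagonal_operator K v l \<circ> adjoint U"
  shows "l summable_on K"
proof -
  have vv: "\<And>j k. j \<in> K \<Longrightarrow> k \<in> K \<Longrightarrow> v j \<bullet> v k = (if j = k then 1 else 0)"
    using v unfolding orthonormal_basis_def by auto
  have "U (v k) \<bullet> S (U (v k)) = l k" if k: "k \<in> K" for k
  proof -
    have "adjoint U (U (v k)) = v k"
      by (rule vector_eq_ldot[THEN iffD1]) (simp add: unitary_inner(1,2)[OF U])
    moreover have "diagonal_operator K v l (v k) = l k *\<^sub>R v k"
    proof -
      \<comment> \<open>Only one term is nonzero, so the sum can be evaluated before
        \<open>l\<close> is known to be summable.\<close>
      have "diagonal_operator K v l (v k) = (\<Sum>\<^sub>\<infinity>j\<in>{k}. l j *\<^sub>R rank_one (v j) (v k))"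
        unfolding diagonal_operator_def
        using k by (intro infsum_cong_neutral) (auto simp: rank_one_def vv)
      then show ?thesis
        using k by (simp add: rank_one_def vv)
    qed
    ultimately show ?thesis
      using k by (simp add: dec unitary_inner(1)[OF U] vv)
  qed
  moreover have "(\<lambda>k. U (v k) \<bullet> S (U (v k))) summable_on K"
    using S orthonormal_basis_unitary[OF v U] unfolding covariance_operator_def by blast
  ultimately show ?thesis
    by (simp cong: summable_on_cong)
qed

text \<open>Unique existence justifies speaking of the Gaussian measure with this covariance. The
  vectors \<open>Q i (e k)\<close> are the eigenbases for the previous theorem.\<close>

theorem mainTheorem5:
  fixes \<mu> :: "'p::{finite,linorder} \<Rightarrow> 'h::{real_inner,banach,second_countable_topology} measure"
    and \<Sigma> Q \<Lambda> :: "'p \<Rightarrow> 'h \<Rightarrow> 'h"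
    and K :: "nat set" and v :: "nat \<Rightarrow> 'h" and l :: "'p \<Rightarrow> nat \<Rightarrow> real"
    and B :: "'p \<Rightarrow> 'p \<Rightarrow> 'h \<Rightarrow> 'h"
  assumes "CARD('p) \<ge> 2"
    and "\<And>i. is_gaussian (\<Sigma> i) (\<mu> i)"
    and "orthonormal_basis K v"
    and "\<And>i. eigenvalue_sequence K (\<Sigma> i) (l i)"
    and "\<And>i. \<Lambda> i = diagonal_operator K v (l i)"
    and "\<And>i. unitary (Q i)"
    and "\<And>i. \<Sigma> i = Q i \<circ> \<Lambda> i \<circ> adjoint (Q i)"
    and "\<And>i j. B i j =
           (if i = j then \<Sigma> i
            else Q i \<circ> operator_sqrt (\<Lambda> i) \<circ> operator_sqrt (\<Lambda> j) \<circ> adjoint (Q j))"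
  shows "(\<exists>!\<pi>. is_gaussian (block_operator B) \<pi>) \<and>
         (\<forall>\<pi>. is_gaussian (block_operator B) \<pi> \<longrightarrow> solves_multimarginal_igw \<mu> \<pi>)"
proof -
  note v = assms(3) and Q = assms(6)
  define e where "e k = (if k \<in> K then v k else 0)" for k
  define a where "a i k = (if k \<in> K then l i k else 0)" for i k
  interpret hilbert_padded_basis e
    unfolding e_def hilbert_padded_basis_def by (rule padded_basis_if_orthonormal_basis[OF v])
  have l: "\<And>i k. k \<in> K \<Longrightarrow> 0 \<le> l i k" "\<And>i j k. j \<in> K \<Longrightarrow> k \<in> K \<Longrightarrow> j \<le> k \<Longrightarrow> l i k \<le> l i j"
    using assms(4) unfolding eigenvalue_sequence_def monotone_on_def by blast+
  \<comment> \<open>\<open>K\<close> is an initial segment, so padding with zeros comes after all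
    eigenvalues and keeps the sequence non-increasing.\<close>
  have K: "k \<in> K" if "j \<in> K" "k \<le> j" for j k
    using v that unfolding orthonormal_basis_def by auto
  have a0: "0 \<le> a i k" for i k
    using l by (simp add: a_def)
  have a_dec: "a i (Suc k) \<le> a i k" for i k
    using l K[of "Suc k" k] by (auto simp: a_def)
  have a_bd: "a i k \<le> a i 0" for i k
    using decseq_SucI[of "a i"] a_dec by (simp add: decseq_def)
  have a_sum: "summable (a i)" for i
  proof -
    have "l i summable_on K"
      using assms(2)[of i] assms(7)[of i] unfolding assms(5)
      by (intro spectral_data_summable[OF _ v Q]) (auto simp: is_gaussian_def)
    then have "a i summable_on UNIV"
      by (rule summable_on_cong_neutral[THEN iffD1, rotated -1]) (auto simp: a_def)
    then show ?thesis
      by (rule summable_on_imp_summable)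
  qed
  have l_bd: "l i k \<le> a i 0" if "k \<in> K" for i k
    using a_bd[of i k] a_def[of i k] that by simp
  have \<Lambda>: "\<Lambda> i = diag (a i)" for i
    using diagonal_operator_eq_diag[OF v l(1) a_sum[unfolded a_def[abs_def]] l_bd a0]
    unfolding assms(5) a_def[abs_def] e_def[abs_def] .
  have abs_bd: "\<bar>a i k\<bar> \<le> a i 0" "\<bar>sqrt (a i k)\<bar> \<le> sqrt (a i 0)" for i k
    using a0 a_bd by auto
  have inner_\<Lambda>: "e k \<bullet> \<Lambda> i x = a i k * (e k \<bullet> x)" for i k x
    unfolding \<Lambda> by (rule inner_diag) (rule abs_bd(1))
  have sqrt_\<Lambda>: "operator_sqrt (\<Lambda> i) = diag (\<lambda>k. sqrt (a i k))" for i
    unfolding \<Lambda> by (rule operator_sqrt_diag[OF a0 a_bd])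
  have inner_sqrt: "e k \<bullet> operator_sqrt (\<Lambda> i) x = sqrt (a i k) * (e k \<bullet> x)" for i k x
    unfolding sqrt_\<Lambda> by (rule inner_diag) (rule abs_bd(2))
  \<comment> \<open>Both branches of the definition of \<open>B\<close> have this form: for
    \<open>i = j\<close> the two roots multiply to the eigenvalue of
    \<open>\<Sigma> i\<close>.\<close>
  have B: "Q i (e k) \<bullet> B i j x = sqrt (a i k) * sqrt (a j k) * (Q j (e k) \<bullet> x)" for i j k x
    using a0[of j k] by (simp add: assms(8) assms(7) unitary_inner(1,2)[OF Q] inner_sqrt inner_\<Lambda>)
  have basis: "padded_basis (\<lambda>k. Q i (e k))" for i
  proof -
    have "(\<lambda>k. Q i (e k)) = (\<lambda>k. if k \<in> K then Q i (v k) else 0)"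
      by (auto simp: e_def linear_0[OF unitary_inner(3)[OF Q]])
    then show ?thesis
      using padded_basis_if_orthonormal_basis[OF orthonormal_basis_unitary[OF v Q]] by simp
  qed
  \<comment> \<open>\<open>Q i\<close> is isometric, so it annihilates \<open>e k\<close> only at
    padding indices.\<close>
  have zero: "a i k = 0" if "Q i (e k) = 0" for i k
  proof (rule ccontr)
    assume "a i k \<noteq> 0"
    then have "e k \<bullet> e k = 1"
      using v by (auto simp: a_def e_def orthonormal_basis_def)
    then show False
      using that unitary_inner(1)[OF Q, of i "e k" "e k"] by simp
  qed
  have \<mu>: "is_gaussian (B i i) (\<mu> i)" for i
    using assms(2) by (simp add: assms(8))
  have "\<exists>\<pi>. is_gaussian (block_operator B) \<pi>"
    by (rule comonotone_gaussian_solves_igw(1)[where e = "\<lambda>i k. Q i (e k)",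
          OF \<mu> basis B zero a0 a_dec a_sum])
  moreover have "solves_multimarginal_igw \<mu> \<pi>" if "is_gaussian (block_operator B) \<pi>" for \<pi>
    by (rule comonotone_gaussian_solves_igw(2)[where e = "\<lambda>i k. Q i (e k)",
          OF \<mu> basis B zero a0 a_dec a_sum that])
  ultimately show ?thesis
    by (meson is_gaussian_unique)
qed

end
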